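(* Let $\mathcal{S}$ be any center-tail system in a connected planar graph $G$ (with a fixed drawing in the plane; the system is taken in the dual graph $G^*$). Then the spanning tree congestion $s(G)$ and the congestion indicator $\mathrm{CI}(\mathcal{S})$ satisfy $$s(G)\ge \mathrm{CI}(\mathcal{S}).$$
   Context: **Spanning tree congestion.** Let $T$ be a spanning tree in a graph $G$ ($T$ is a subgraph of $G$). For each edge $e$ of $T$ let $A_e$ and $B_e$ be the vertex sets of the components of $T-e$, and let $e_G(A_e,B_e)$ be the number of edges in $G$ with one end vertex in $A_e$ and the other end vertex in $B_e$. Put $\mathrm{ec}(G:T)=\max_{e\in E(T)}e_G(A_e,B_e)$ and $s(G)=\min\{\mathrm{ec}(G:T): T \text{ is a spanning tree of } G\}$. **Dual graph.** For a connected plane graph $G$ (a planar graph with a fixed drawing in the plane), the dual graph $G^*$ is the graph whose vertices are the faces of $G$, including the exterior (unbounded) face, denoted $O$, and whose edges are in a bijective correspondence with the edges of $G$: the edge $e^*$ of $G^*$ corresponding to an edge $e$ of $G$ joins the faces which are on different sides of $e$. The graph $G^*$ does not have to be simple even when $G$ is simple. **Outer edges and index.** An edge $e$ of $G$ is an *outer edge* if it occurs in the boundary of the exterior face and one of the interior faces. For each outer edge $e$ and each bounded face $F$ of $G$, the *index* $i(F,e)$ is the length of a shortest path in $G^*$ which joins the exterior face $O$ with $F$ and satisfies the additional condition that its first edge is $e^*$. **Center-tail system.** A *center-tail system* $\mathcal{S}$ in the dual graph $G^*$ of a plane graph $G$ consists of: (1) A set $C$ of vertices of $G^*$ spanning a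 connected subgraph of $G^*$; the set $C$ is called a *center*. (2) A set of paths in $G^*$ joining some vertices of the center with the exterior face $O$. Each such path is called a *tail*. The *tip* of a tail is the last vertex of the corresponding path before it reaches the exterior face. (3) An assignment of *opposite tails* for outer edges of $G$: for each outer edge $e$ of $G$ one of the tails is assigned to be the opposite tail of $e$; it is denoted $N(e)$ and its tip is denoted $t(e)$. **Congestion indicator.** The congestion indicator $\mathrm{CI}(\mathcal{S})$ of a center-tail system $\mathcal{S}$ is the minimum of the following three numbers: (1) $\min_{F,H,f,h}\bigl(i(F,f)+i(H,h)+1\bigr)$, where the minimum is taken over all pairs $F,H$ of adjacent vertices in the center $C$ and over all pairs $f,h$ of outer edges with $f\ne h$. If the center contains just one face, this minimum is taken to be $\infty$. (2) $\min_e i(t(e),e)+1$, where the minimum is taken over all outer edges $e$ of $G$. (3) $\min_e\min_{F\in N(e)}\min_{\tilde e\ne e}\bigl(i(F,e)+i(\widetilde F,\tilde e)+1\bigr)$, where the first minimum is taken over all outer edges $e$ of $G$; the second minimum is over vertices $F$ from the path $N(e)$, and $\widetilde F$ is the vertex in $N(e)$ which follows immediately after $F$ if one moves along $N(e)$ from $F$ to $t(e)$; and the third minimum is over all outer edges $\tilde e$ different from $e$. *)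

theory Defs
  imports "HOL-Analysis.Analysis"
begin

section \<open>Undirected multigraphs\<close>

text \<open>
  Each edge carries the set of its end vertices: two elements for an ordinary edge, one for a
  loop. Parallel edges are different elements of the edge type with equal end sets. The same
  type serves for a graph and for its dual.
\<close>

record ('v, 'e) multigraph =
  verts :: "'v set"
  edges :: "'e set"
  ends :: "'e \<Rightarrow> 'v set"

text \<open>
  Parallel edges are admitted; simple graphs are the special case where the end sets are
  pairwise different. Loops are excluded: they never lie in a spanning tree and never count in
  a congestion, but would be outer edges of small index. (A pendant edge with a
  loop drawn at one of its ends has spanning tree congestion 1, but congestion indicator 2.)
\<close>

definition finite_loopless :: "('v, 'e) multigraph \<Rightarrow> bool" where
  "finite_loopless G \<longleftrightarrow> finite (verts G) \<and> finite (edges G) \<and>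
     (\<forall>e\<in>edges G. ends G e \<subseteq> verts G \<and> card (ends G e) = 2)"

text \<open>A path (no repeated vertex) is given by the lists of its vertices and of its edges.\<close>

definition graph_path :: "('v, 'e) multigraph \<Rightarrow> 'v list \<Rightarrow> 'e list \<Rightarrow> bool" where
  "graph_path G vs es \<longleftrightarrow>
     set vs \<subseteq> verts G \<and> set es \<subseteq> edges G \<and> length vs = Suc (length es) \<and> distinct vs \<and>
     (\<forall>i<length es. ends G (es ! i) = {vs ! i, vs ! Suc i})"

definition joined :: "('v, 'e) multigraph \<Rightarrow> 'v \<Rightarrow> 'v \<Rightarrow> bool" where
  "joined G u v \<longleftrightarrow> (\<exists>vs es. graph_path G vs es \<and> hd vs = u \<and> last vs = v)"

definition graph_connected :: "('v, 'e) multigraph \<Rightarrow> bool" where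
  "graph_connected G \<longleftrightarrow> verts G \<noteq> {} \<and> (\<forall>u\<in>verts G. \<forall>v\<in>verts G. joined G u v)"

definition graph_components :: "('v, 'e) multigraph \<Rightarrow> 'v set set" where
  "graph_components G = (\<lambda>u. {v \<in> verts G. joined G u v}) ` verts G"

text \<open>
  A cycle is a path closed up by one further edge; this covers loops and pairs of parallel edges.
\<close>

definition graph_acyclic :: "('v, 'e) multigraph \<Rightarrow> bool" where
  "graph_acyclic G \<longleftrightarrow>
     \<not> (\<exists>vs es e. graph_path G vs es \<and> e \<in> edges G - set es \<and> ends G e = {last vs, hd vs})"

definition adjacent :: "('v, 'e) multigraph \<Rightarrow> 'v \<Rightarrow> 'v \<Rightarrow> bool" where
  "adjacent G u v \<longleftrightarrow> u \<noteq> v \<and> (\<exists>e\<in>edges G. ends G e = {u, v})"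

definition induced :: "('v, 'e) multigraph \<Rightarrow> 'v set \<Rightarrow> ('v, 'e) multigraph" where
  "induced G C = G\<lparr>verts := C, edges := {e \<in> edges G. ends G e \<subseteq> C}\<rparr>"

definition spanning_subgraph :: "('v, 'e) multigraph \<Rightarrow> 'e set \<Rightarrow> ('v, 'e) multigraph" where
  "spanning_subgraph G T = G\<lparr>edges := T\<rparr>"


section \<open>Spanning tree congestion\<close>

text \<open>A spanning tree is represented by its edge set.\<close>

definition spanning_tree :: "('v, 'e) multigraph \<Rightarrow> 'e set \<Rightarrow> bool" where
  "spanning_tree G T \<longleftrightarrow> T \<subseteq> edges G \<and>
     graph_connected (spanning_subgraph G T) \<and> graph_acyclic (spanning_subgraph G T)"

definition edges_between :: "('v, 'e) multigraph \<Rightarrow> 'v set \<Rightarrow> 'v set \<Rightarrow> 'e set" where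
  "edges_between G A B = {f \<in> edges G. \<exists>a\<in>A. \<exists>b\<in>B. ends G f = {a, b}}"

text \<open>For an edge \<open>e\<close> of a spanning tree \<open>T\<close> the graph \<open>T - e\<close> has exactly two components.\<close>

definition edge_congestion :: "('v, 'e) multigraph \<Rightarrow> 'e set \<Rightarrow> 'e \<Rightarrow> nat" where
  "edge_congestion G T e =
     card (\<Union>{edges_between G A B | A B.
       A \<in> graph_components (spanning_subgraph G (T - {e})) \<and>
       B \<in> graph_components (spanning_subgraph G (T - {e})) \<and> A \<noteq> B})"

text \<open>
  The maximum is over a nonempty set unless the graph has a single vertex; a loopless plane graph
  with a single vertex has no bounded face, hence no center-tail system.
\<close>

definition tree_congestion :: "('v, 'e) multigraph \<Rightarrow> 'e set \<Rightarrow> nat" where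
  "tree_congestion G T = Max (edge_congestion G T ` T)"

definition spanning_tree_congestion :: "('v, 'e) multigraph \<Rightarrow> nat" where
  "spanning_tree_congestion G = Min (tree_congestion G ` {T. spanning_tree G T})"


section \<open>Drawings and dual graphs\<close>

text \<open>The plane is the type \<^typ>\<open>complex\<close>.\<close>

record ('v, 'e) drawing =
  point :: "'v \<Rightarrow> complex"
  curve :: "'e \<Rightarrow> real \<Rightarrow> complex"

definition open_curve :: "('v, 'e) drawing \<Rightarrow> 'e \<Rightarrow> complex set" where
  "open_curve D e =
     path_image (curve D e) - {pathstart (curve D e), pathfinish (curve D e)}"

definition plane_drawing :: "('v, 'e) multigraph \<Rightarrow> ('v, 'e) drawing \<Rightarrow> bool" where
  "plane_drawing G D \<longleftrightarrow>
     inj_on (point D) (verts G) \<and>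
     (\<forall>e\<in>edges G. arc (curve D e) \<and>
        {pathstart (curve D e), pathfinish (curve D e)} = point D ` ends G e \<and>
        open_curve D e \<inter> point D ` verts G = {}) \<and>
     (\<forall>e\<in>edges G. \<forall>f\<in>edges G. e \<noteq> f \<longrightarrow> open_curve D e \<inter> open_curve D f = {})"

definition drawn_set :: "('v, 'e) multigraph \<Rightarrow> ('v, 'e) drawing \<Rightarrow> complex set" where
  "drawn_set G D = point D ` verts G \<union> (\<Union>e\<in>edges G. path_image (curve D e))"

definition faces :: "('v, 'e) multigraph \<Rightarrow> ('v, 'e) drawing \<Rightarrow> complex set set" where
  "faces G D = components (- drawn_set G D)"

definition bounded_faces :: "('v, 'e) multigraph \<Rightarrow> ('v, 'e) drawing \<Rightarrow> complex set set" where
  "bounded_faces G D = {F \<in> faces G D. bounded F}"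

definition outer_face :: "('v, 'e) multigraph \<Rightarrow> ('v, 'e) drawing \<Rightarrow> complex set" where
  "outer_face G D = (THE F. F \<in> faces G D \<and> \<not> bounded F)"

text \<open>
  The dual edge \<open>e\<^sup>*\<close> is identified with \<open>e\<close>. Its ends are the faces having \<open>e\<close> in
  their boundary; there is only one such face if both sides of \<open>e\<close> belong to the same
  face, and then \<open>e\<^sup>*\<close> is a loop.
\<close>

definition dual_graph ::
    "('v, 'e) multigraph \<Rightarrow> ('v, 'e) drawing \<Rightarrow> (complex set, 'e) multigraph" where
  "dual_graph G D =
     \<lparr>verts = faces G D, edges = edges G,
      ends = (\<lambda>e. {F \<in> faces G D. path_image (curve D e) \<subseteq> frontier F})\<rparr>"

definition outer_edges :: "('v, 'e) multigraph \<Rightarrow> ('v, 'e) drawing \<Rightarrow> 'e set" where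
  "outer_edges G D =
     {e \<in> edges G. outer_face G D \<in> ends (dual_graph G D) e \<and>
        (\<exists>F \<in> bounded_faces G D. F \<in> ends (dual_graph G D) e)}"

text \<open>
  The value is \<open>\<infinity>\<close> if no path from the outer face to \<open>F\<close> starts with \<open>e\<^sup>*\<close>, which can
  happen if \<open>G\<close> has cut vertices.
\<close>

definition index ::
    "('v, 'e) multigraph \<Rightarrow> ('v, 'e) drawing \<Rightarrow> complex set \<Rightarrow> 'e \<Rightarrow> enat" where
  "index G D F e =
     Inf {enat (length es) | Fs es. graph_path (dual_graph G D) Fs es \<and>
            hd Fs = outer_face G D \<and> last Fs = F \<and> es \<noteq> [] \<and> hd es = e}"


section \<open>Center-tail systems\<close>

type_synonym 'e dual_path = "complex set list \<times> 'e list"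

record 'e center_tail =
  center :: "complex set set"
  tails :: "'e dual_path set"
  opp :: "'e \<Rightarrow> 'e dual_path"

text \<open>
  The center consists of bounded faces (the index is only meaningful for those) and is nonempty,
  as part of connectedness. The value of \<open>opp\<close> matters on outer edges only.
\<close>

definition center_tail_system ::
    "('v, 'e) multigraph \<Rightarrow> ('v, 'e) drawing \<Rightarrow> 'e center_tail \<Rightarrow> bool" where
  "center_tail_system G D S \<longleftrightarrow>
     center S \<subseteq> bounded_faces G D \<and>
     graph_connected (induced (dual_graph G D) (center S)) \<and>
     (\<forall>(Fs, es) \<in> tails S. graph_path (dual_graph G D) Fs es \<and>
        hd Fs \<in> center S \<and> last Fs = outer_face G D) \<and>
     (\<forall>e \<in> outer_edges G D. opp S e \<in> tails S)"

definition tip :: "'e dual_path \<Rightarrow> complex set" where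
  "tip N = last (butlast (fst N))"

text \<open>
  In the third number, \<open>F\<close> and its successor are consecutive entries of \<open>butlast (fst N)\<close>, the
  part of the tail \<open>N\<close> that ends at the tip. Minima over empty sets are \<open>\<infinity>\<close>.
\<close>

definition congestion_indicator ::
    "('v, 'e) multigraph \<Rightarrow> ('v, 'e) drawing \<Rightarrow> 'e center_tail \<Rightarrow> enat" where
  "congestion_indicator G D S = Min
     {Inf {index G D F f + index G D H h + 1 | F H f h.
             F \<in> center S \<and> H \<in> center S \<and> adjacent (dual_graph G D) F H \<and>
             f \<in> outer_edges G D \<and> h \<in> outer_edges G D \<and> f \<noteq> h},
      Inf {index G D (tip (opp S e)) e + 1 | e. e \<in> outer_edges G D},
      Inf {index G D (Fs ! k) e + index G D (Fs ! Suc k) e' + 1 | Fs k e e'.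
             e \<in> outer_edges G D \<and> e' \<in> outer_edges G D \<and> e' \<noteq> e \<and>
             Fs = butlast (fst (opp S e)) \<and> Suc k < length Fs}}"

end

theory Submission
  imports Defs
begin

text \<open>
  Fix a spanning tree \<open>T\<close>. A drawn tree does not separate the plane, so the dual edges \<open>e\<^sup>*\<close> with
  \<open>e \<notin> T\<close> connect every face with \<open>O\<close>. Label a bounded face \<open>F\<close> with the edge \<open>f\<close> next to \<open>O\<close> on
  such a connection \<open>P\<close>; it is unique, and \<open>i(F, f)\<close> is at most the length of \<open>P\<close>. If adjacent
  faces have different labels, the edge \<open>e\<close> between them is in \<open>T\<close>, and all edges crossed by the two
  disjoint connections to \<open>O\<close>, and \<open>e\<close> itself, join the two components of \<open>T - e\<close>. So if
  \<open>ec(G : T)\<close> were smaller than the first number of the indicator, all faces of the center would have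
  the same label \<open>e\<close>; if it were smaller than the third, the label would be constant along \<open>N(e)\<close>;
  and then the last edge of \<open>N(e)\<close> contradicts the second number.

  The planarity arguments all come down to this: the fundamental cycle of an edge \<open>g \<notin> T\<close> is a Jordan
  curve; the two faces at \<open>g\<close> are on different sides of it, and every dual path which does not cross
  the curve remains on one side.
\<close>

section \<open>Paths and trees\<close>

text \<open>Its reflexive transitive closure describes \<open>joined\<close>, so that transitivity
  of being joined does not require removing repeated vertices from a concatenation of paths.\<close>

definition steps :: "('v, 'e) multigraph \<Rightarrow> ('v \<times> 'v) set" where
  "steps G = {(u, v). u \<in> verts G \<and> v \<in> verts G \<and> (\<exists>e\<in>edges G. ends G e = {u, v})}"

lemma graph_path_Nil [simp]: "graph_path G vs [] \<longleftrightarrow> (\<exists>v\<in>verts G. vs = [v])"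
  by (auto simp: graph_path_def length_Suc_conv)

lemma graph_path_Cons:
  "graph_path G vs (e # es) \<longleftrightarrow>
     (\<exists>v ws. vs = v # ws \<and> v \<in> verts G \<and> v \<notin> set ws \<and> e \<in> edges G \<and>
        ends G e = {v, hd ws} \<and> graph_path G ws es)"
proof (cases vs)
  case Nil
  then show ?thesis by (auto simp: graph_path_def)
next
  case (Cons v ws)
  have "ws ! 0 = hd ws" if "length ws = Suc (length es)"
    using that by (cases ws) auto
  then show ?thesis
    unfolding Cons graph_path_def by (auto simp: All_less_Suc2)
qed

lemma graph_path_verts: "graph_path G vs es \<Longrightarrow> set vs \<subseteq> verts G"
  and graph_path_edges: "graph_path G vs es \<Longrightarrow> set es \<subseteq> edges G"
  and graph_path_length: "graph_path G vs es \<Longrightarrow> length vs = Suc (length es)"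
  and graph_path_distinct: "graph_path G vs es \<Longrightarrow> distinct vs"
  and graph_path_ends: "graph_path G vs es \<Longrightarrow> i < length es \<Longrightarrow> ends G (es ! i) = {vs ! i, vs ! Suc i}"
  by (auto simp: graph_path_def)

lemma graph_path_not_Nil: "graph_path G vs es \<Longrightarrow> vs \<noteq> []"
  by (auto simp: graph_path_def)

lemma graph_path_ends_subset:
  assumes "graph_path G vs es" "e \<in> set es" shows "ends G e \<subseteq> set vs"
proof -
  obtain i where "i < length es" "e = es ! i" using assms(2) by (auto simp: in_set_conv_nth)
  then show ?thesis using assms(1) by (auto simp: graph_path_def)
qed

text \<open>A later occurrence of the first edge would place the first vertex among the later
  vertices.\<close>

lemma graph_path_distinct_edges: "graph_path G vs es \<Longrightarrow> distinct es"
proof (induction es arbitrary: vs)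
  case (Cons e es)
  then obtain v ws where "v \<notin> set ws" "ends G e = {v, hd ws}" "graph_path G ws es"
    by (auto simp: graph_path_Cons)
  then show ?case using Cons.IH graph_path_ends_subset by fastforce
qed simp

lemma graph_path_take:
  "graph_path G vs es \<Longrightarrow> k \<le> length es \<Longrightarrow> graph_path G (take (Suc k) vs) (take k es)"
  unfolding graph_path_def by (auto dest: in_set_takeD simp: subset_iff)

lemma graph_path_drop:
  "graph_path G vs es \<Longrightarrow> k \<le> length es \<Longrightarrow> graph_path G (drop k vs) (drop k es)"
  unfolding graph_path_def by (auto dest: in_set_dropD simp: subset_iff)

lemma graph_path_snoc:
  assumes "graph_path G vs es" "w \<in> verts G" "w \<notin> set vs" "e \<in> edges G" "ends G e = {last vs, w}"
  shows "graph_path G (vs @ [w]) (es @ [e])"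
proof -
  have l: "length vs = Suc (length es)" using assms graph_path_length by blast
  then have "last vs = vs ! length es" using graph_path_not_Nil[OF assms(1)] by (simp add: last_conv_nth)
  then show ?thesis using assms l unfolding graph_path_def
    by (auto simp: nth_append less_Suc_eq)
qed

text \<open>If the new vertex already lies on the path, the path is cut off there; otherwise it is
  extended by one edge.\<close>

lemma joined_steps:
  assumes "joined G u v" "(v, w) \<in> steps G" shows "joined G u w"
proof -
  obtain vs es where p: "graph_path G vs es" "hd vs = u" "last vs = v"
    using assms(1) by (auto simp: joined_def)
  obtain e where e: "e \<in> edges G" "ends G e = {v, w}" "w \<in> verts G"
    using assms(2) by (auto simp: steps_def)
  show ?thesis
  proof (cases "w \<in> set vs")
    case True
    then obtain k where k: "k < length vs" "vs ! k = w" by (auto simp: in_set_conv_nth)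
    then have "graph_path G (take (Suc k) vs) (take k es)"
      using p(1) graph_path_length[OF p(1)] by (intro graph_path_take) auto
    moreover have "last (take (Suc k) vs) = w" "hd (take (Suc k) vs) = u"
      using k p(2) by (auto simp: take_Suc_conv_app_nth hd_append hd_conv_nth)
    ultimately show ?thesis unfolding joined_def by blast
  next
    case False
    then have "graph_path G (vs @ [w]) (es @ [e])" using p e by (intro graph_path_snoc) auto
    moreover have "hd (vs @ [w]) = u" using p(2) graph_path_not_Nil[OF p(1)] by simp
    ultimately show ?thesis unfolding joined_def by (metis last_snoc)
  qed
qed

lemma graph_path_steps:
  assumes "graph_path G vs es" shows "(hd vs, last vs) \<in> (steps G)\<^sup>*"
  using assms
proof (induction es arbitrary: vs)
  case (Cons e es)
  then obtain v ws where w: "vs = v # ws" "v \<in> verts G" "e \<in> edges G"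
    "ends G e = {v, hd ws}" "graph_path G ws es"
    by (auto simp: graph_path_Cons)
  then have "ws \<noteq> []" "hd ws \<in> verts G"
    using graph_path_not_Nil graph_path_verts by fastforce+
  then show ?case using w Cons.IH[OF w(5)]
    by (auto simp: steps_def intro: converse_rtrancl_into_rtrancl)
qed auto

lemma joined_iff: "joined G u v \<longleftrightarrow> u \<in> verts G \<and> (u, v) \<in> (steps G)\<^sup>*"
proof
  assume "joined G u v"
  then show "u \<in> verts G \<and> (u, v) \<in> (steps G)\<^sup>*"
    using graph_path_steps graph_path_verts graph_path_not_Nil
    unfolding joined_def by (metis hd_in_set subsetD)
next
  assume a: "u \<in> verts G \<and> (u, v) \<in> (steps G)\<^sup>*"
  then have "(u, v) \<in> (steps G)\<^sup>*" by simp
  then show "joined G u v"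
  proof induction
    case base
    have "graph_path G [u] []" using a by simp
    then show ?case unfolding joined_def by (metis last.simps list.sel(1))
  qed (rule joined_steps)
qed

lemma joined_refl: "u \<in> verts G \<Longrightarrow> joined G u u"
  by (simp add: joined_iff)

lemma steps_sym: "sym ((steps G)\<^sup>*)"
  by (intro sym_rtrancl) (auto simp: sym_def steps_def insert_commute)

lemma joined_verts: "joined G u v \<Longrightarrow> u \<in> verts G \<and> v \<in> verts G"
  unfolding joined_def by (metis graph_path_not_Nil graph_path_verts hd_in_set last_in_set subsetD)

lemma joined_sym: "joined G u v \<Longrightarrow> joined G v u"
  by (metis joined_iff joined_verts steps_sym symD)

lemma joined_trans: "joined G u v \<Longrightarrow> joined G v w \<Longrightarrow> joined G u w"
  by (auto simp: joined_iff)

lemma rtrancl_leaves: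
  assumes "(u, v) \<in> r\<^sup>*" "u \<in> X" "v \<notin> X"
  obtains a b where "(a, b) \<in> r" "a \<in> X" "b \<notin> X"
  using assms by (induction) auto

section \<open>Spanning trees and edges between components\<close>

lemma spanning_subgraph_simps [simp]:
  "verts (spanning_subgraph G T) = verts G" "edges (spanning_subgraph G T) = T"
  "ends (spanning_subgraph G T) = ends G"
  by (auto simp: spanning_subgraph_def)

lemma graph_path_spanning_subgraph:
  "T \<subseteq> edges G \<Longrightarrow> graph_path (spanning_subgraph G T) vs es \<longleftrightarrow> graph_path G vs es \<and> set es \<subseteq> T"
  by (auto simp: graph_path_def)

lemma steps_spanning_subgraph_mono:
  "T \<subseteq> T' \<Longrightarrow> (steps (spanning_subgraph G T))\<^sup>* \<subseteq> (steps (spanning_subgraph G T'))\<^sup>*"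
  by (intro rtrancl_mono) (auto simp: steps_def)

lemma steps_spanning_subgraph_edges: "steps (spanning_subgraph G (edges G)) = steps G"
  by (auto simp: steps_def)

text \<open>Among the edge sets that connect all vertices, one of least cardinality is acyclic,
  since an edge on a cycle could be dropped.\<close>

lemma exists_spanning_tree:
  assumes "finite (edges G)" "graph_connected G"
  shows "\<exists>T. spanning_tree G T"
proof -
  let ?P = "\<lambda>T. T \<subseteq> edges G \<and> graph_connected (spanning_subgraph G T)"
  have "?P (edges G)" using assms(2)
    by (auto simp: graph_connected_def joined_iff steps_spanning_subgraph_edges)
  then obtain T where T: "?P T" and min: "\<And>T'. ?P T' \<Longrightarrow> card T \<le> card T'"
    using ex_has_least_nat[of ?P "edges G" card] by blast
  have "graph_acyclic (spanning_subgraph G T)"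
    unfolding graph_acyclic_def
  proof (safe, simp_all)
    fix vs es e
    assume p: "graph_path (spanning_subgraph G T) vs es" and e: "e \<in> T" "e \<notin> set es"
      and ends: "ends G e = {last vs, hd vs}"
    let ?H = "spanning_subgraph G (T - {e})"
    have "graph_path ?H vs es" using p e T
      by (subst graph_path_spanning_subgraph) (auto simp: graph_path_spanning_subgraph)
    then have *: "(hd vs, last vs) \<in> (steps ?H)\<^sup>*" by (rule graph_path_steps)
    then have **: "(last vs, hd vs) \<in> (steps ?H)\<^sup>*" using steps_sym by (metis symD)
    \<comment> \<open>The edge \<open>e\<close> is replaced by the rest of the cycle, traversed in
      either direction.\<close>
    have "steps (spanning_subgraph G T) \<subseteq> (steps ?H)\<^sup>*"
    proof
      fix z assume "z \<in> steps (spanning_subgraph G T)"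
      then obtain u v f where z: "z = (u, v)" "u \<in> verts G" "v \<in> verts G" "f \<in> T" "ends G f = {u, v}"
        by (auto simp: steps_def)
      show "z \<in> (steps ?H)\<^sup>*"
      proof (cases "f = e")
        case True
        then have "u = last vs \<and> v = hd vs \<or> v = last vs \<and> u = hd vs"
          using z(5) ends by (auto simp: doubleton_eq_iff)
        then show ?thesis using * ** z by auto
      next
        case False
        then have "z \<in> steps ?H" using z by (auto simp: steps_def)
        then show ?thesis by blast
      qed
    qed
    then have "(steps (spanning_subgraph G T))\<^sup>* \<subseteq> (steps ?H)\<^sup>*"
      by (metis rtrancl_idemp rtrancl_mono)
    then have "?P (T - {e})" using T by (auto simp: graph_connected_def joined_iff)
    then have "card T \<le> card (T - {e})" by (rule min)
    moreover have "finite T" using T assms finite_subset by blast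
    ultimately show False using e(1) by (metis card_Diff1_less leD)
  qed
  then show ?thesis using T unfolding spanning_tree_def by blast
qed

text \<open>Every lower bound on the congestion is obtained by exhibiting a set of edges whose ends
  lie in different components of \<open>T - {e}\<close>. This form avoids naming the two
  components.\<close>

lemma edge_congestion_ge:
  assumes "finite (edges G)" "X \<subseteq> edges G"
    and "\<And>g. g \<in> X \<Longrightarrow> \<exists>u v. u \<in> verts G \<and> v \<in> verts G \<and> ends G g = {u, v} \<and>
      \<not> joined (spanning_subgraph G (T - {e})) u v"
  shows "card X \<le> edge_congestion G T e"
  unfolding edge_congestion_def
proof (rule card_mono)
  let ?H = "spanning_subgraph G (T - {e})"
  let ?U = "\<Union>{edges_between G A B | A B. A \<in> graph_components ?H \<and> B \<in> graph_components ?H \<and> A \<noteq> B}"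
  have "?U \<subseteq> edges G" by (auto simp: edges_between_def)
  then show "finite ?U" using assms(1) finite_subset by blast
  show "X \<subseteq> ?U"
  proof
    fix g assume g: "g \<in> X"
    obtain u v where uv: "u \<in> verts G" "v \<in> verts G" "ends G g = {u, v}" "\<not> joined ?H u v"
      using assms(3)[OF g] by blast
    let ?C = "\<lambda>u. {v \<in> verts ?H. joined ?H u v}"
    have "?C u \<in> graph_components ?H" "?C v \<in> graph_components ?H"
      using uv by (auto simp: graph_components_def)
    moreover have "u \<in> ?C u" "v \<in> ?C v" "v \<notin> ?C u" using uv by (auto intro: joined_refl)
    moreover have "g \<in> edges_between G (?C u) (?C v)"
      using g assms(2) uv \<open>u \<in> ?C u\<close> \<open>v \<in> ?C v\<close> unfolding edges_between_def by blast
    ultimately show "g \<in> ?U" by blast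
  qed
qed

lemma joined_edge:
  assumes "e \<in> edges G" "ends G e = {u, v}" "u \<in> verts G" "v \<in> verts G"
  shows "joined G u v"
  unfolding joined_iff using assms by (auto simp: steps_def)

lemma joined_spanning_subgraph_mono:
  "joined (spanning_subgraph G T) u v \<Longrightarrow> T \<subseteq> T' \<Longrightarrow> joined (spanning_subgraph G T') u v"
  unfolding joined_iff using steps_spanning_subgraph_mono[of T T' G] by auto


section \<open>Faces along an edge on a cycle\<close>

text \<open>Janiszewski's theorem: two closed sets, one of them compact, with connected intersection
  separate two points together only if one of them does so alone.\<close>

lemma connected_component_Un_closed:
  fixes x y :: complex
  assumes "compact A" "closed B" "connected (A \<inter> B)"
    and "connected_component (- A) x y" "connected_component (- B) x y"
  shows "connected_component (- (A \<union> B)) x y"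
  using Janiszewski assms by blast

lemma frontier_component_Compl:
  assumes "closed K" "F \<in> components (- K)" "p \<in> closure F" "p \<in> K"
  shows "p \<in> frontier F"
proof -
  have "p \<notin> F" using assms in_components_subset by fastforce
  then show ?thesis using assms(3) interior_subset unfolding frontier_def by fastforce
qed

text \<open>
  Janiszewski's theorem, applied to \<open>C\<close> and \<open>K - g\<close>: two points close to \<open>g\<close> and on the same side
  of \<open>C\<close> are separated by neither of these sets, hence not by their union \<open>K\<close>.
\<close>

lemma jordan_arc_faces:
  fixes c :: "real \<Rightarrow> complex"
  assumes c: "simple_path c" "pathfinish c = pathstart c" "path_image c \<subseteq> K"
    and K: "closed K" "closed (K - g)"
    and g: "g \<subseteq> path_image c" "connected g" "g \<noteq> {}" "connected (path_image c - g)"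
  obtains F H U where "F \<in> components (- K)" "H \<in> components (- K)"
    "F \<subseteq> inside (path_image c)" "H \<subseteq> outside (path_image c)"
    "g \<subseteq> frontier F" "g \<subseteq> frontier H" "open U" "g \<subseteq> U" "U \<subseteq> g \<union> F \<union> H"
proof -
  let ?C = "path_image c"
  have J: "connected (inside ?C)" "connected (outside ?C)" "inside ?C \<union> outside ?C = - ?C"
    "frontier (inside ?C) = ?C" "frontier (outside ?C) = ?C"
    using Jordan_inside_outside[OF c(1,2)] by simp_all
  obtain p where p: "p \<in> g" using g by blast
  \<comment> \<open>This is an open neighbourhood of \<open>g\<close> that meets \<open>K\<close> in
    \<open>g\<close> only.\<close>
  define U where "U = connected_component_set (- (K - g)) p"
  have U: "open U" unfolding U_def by (rule open_connected_component[OF open_Compl[OF K(2)]])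
  have gU: "g \<subseteq> U" unfolding U_def using p g(2) by (intro connected_component_maximal) auto
  have U_sub: "U \<subseteq> - (K - g)" unfolding U_def by (rule connected_component_subset)
  have same: "connected_component (- K) x y"
    if "x \<in> U" "y \<in> U" "connected_component (- ?C) x y" for x y
  proof -
    have "connected_component (- (K - g)) x y"
      using that(1,2) unfolding U_def mem_Collect_eq
      by (metis connected_component_sym connected_component_trans)
    \<comment> \<open>Connectedness of the cycle without \<open>g\<close> is the hypothesis that
      Janiszewski's theorem needs here.\<close>
    moreover have "?C \<inter> (K - g) = ?C - g" using c(3) by blast
    moreover have "compact ?C" using c(1) by (simp add: compact_simple_path_image)
    ultimately have "connected_component (- (?C \<union> (K - g))) x y"
      using K(2) g(4) that(3) by (intro connected_component_Un_closed) auto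
    moreover have "?C \<union> (K - g) = K" using c(3) g(1) by blast
    ultimately show ?thesis by simp
  qed
  \<comment> \<open>The set \<open>S\<close> stands for the inside or the outside of the curve.
    Since \<open>g\<close> lies in the frontier of \<open>S\<close>, points of \<open>S\<close>
    inside \<open>U\<close> come arbitrarily close to every point of \<open>g\<close>, and by
    \<open>same\<close> they all belong to one face.\<close>
  have face: "\<exists>F. F \<in> components (- K) \<and> F \<subseteq> S \<and> g \<subseteq> frontier F \<and> U \<inter> S \<subseteq> F"
    if S: "connected S" "S \<subseteq> - ?C" "frontier S = ?C"
      and Sc: "\<And>x y. connected_component (- ?C) x y \<Longrightarrow> x \<in> S \<Longrightarrow> y \<in> S" for S
  proof -
    have near: "\<exists>x. x \<in> V \<inter> U \<inter> S" if "open V" "q \<in> V" "q \<in> g" for V q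
    proof -
      have "q \<in> closure S" using that(3) g(1) S(3) by (auto simp: frontier_def)
      moreover have "open (V \<inter> U)" "q \<in> V \<inter> U" using that U gU by auto
      ultimately show ?thesis using open_Int_closure_eq_empty[of "V \<inter> U" S] by blast
    qed
    obtain x where x: "x \<in> U" "x \<in> S" using near[of UNIV p] p by auto
    then have "x \<notin> K" using U_sub S(2) g(1) by auto
    define F where "F = connected_component_set (- K) x"
    have F: "F \<in> components (- K)" unfolding F_def using \<open>x \<notin> K\<close> by (auto simp: components_def)
    have "F \<subseteq> S"
    proof
      fix y assume "y \<in> F"
      then have "connected_component (- ?C) x y" unfolding F_def
        using c(3) connected_component_of_subset[of "- K" x y "- ?C"] by simp
      then show "y \<in> S" using Sc x(2) by blast
    qed
    moreover have US: "U \<inter> S \<subseteq> F"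
    proof
      fix y assume y: "y \<in> U \<inter> S"
      have "connected_component (- ?C) x y" using S(1,2) x(2) y
        unfolding connected_component_def by (intro exI[of _ S]) simp
      then show "y \<in> F" unfolding F_def using same x y by auto
    qed
    moreover have "g \<subseteq> frontier F"
    proof
      fix q assume q: "q \<in> g"
      have "q \<in> closure F"
      proof (rule ccontr)
        assume "q \<notin> closure F"
        then obtain x where "x \<in> - closure F \<inter> U \<inter> S" using near[of "- closure F" q] q by auto
        then show False using US closure_subset[of F] by blast
      qed
      moreover have "q \<in> K" using q g(1) c(3) by blast
      ultimately show "q \<in> frontier F" using frontier_component_Compl[OF K(1) F] by blast
    qed
    ultimately show ?thesis using F by blast
  qed
  obtain F where F: "F \<in> components (- K)" "F \<subseteq> inside ?C" "g \<subseteq> frontier F" "U \<inter> inside ?C \<subseteq> F"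
  proof -
    have "inside ?C \<subseteq> - ?C" using J(3) by blast
    from face[OF J(1) this J(4)] show thesis
      using inside_same_component that by blast
  qed
  obtain H where H: "H \<in> components (- K)" "H \<subseteq> outside ?C" "g \<subseteq> frontier H" "U \<inter> outside ?C \<subseteq> H"
  proof -
    have "outside ?C \<subseteq> - ?C" using J(3) by blast
    from face[OF J(2) this J(5)] show thesis
      using outside_same_component that by blast
  qed
  have "U \<subseteq> g \<union> F \<union> H"
  proof
    fix y assume y: "y \<in> U"
    then have "y \<in> inside ?C \<or> y \<in> outside ?C \<or> y \<in> ?C" using J(3) by blast
    then show "y \<in> g \<union> F \<union> H" using y F(4) H(4) U_sub c(3) by blast
  qed
  then show thesis using that F H U gU by blast
qed

section \<open>Arcs and vertices of a plane drawing\<close>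

locale plane_graph =
  fixes G :: "('v, 'e) multigraph" and D :: "('v, 'e) drawing"
  assumes finite_loopless: "finite_loopless G" and plane_drawing: "plane_drawing G D"
begin

abbreviation "K \<equiv> drawn_set G D"
abbreviation "dual \<equiv> dual_graph G D"
abbreviation "outer \<equiv> outer_face G D"
abbreviation "arc_of e \<equiv> path_image (curve D e)"

definition curves :: "'e set \<Rightarrow> complex set" where
  "curves E = (\<Union>e\<in>E. arc_of e)"

lemma finite_verts: "finite (verts G)" and finite_edges: "finite (edges G)"
  and ends_verts: "e \<in> edges G \<Longrightarrow> ends G e \<subseteq> verts G"
  and card_ends: "e \<in> edges G \<Longrightarrow> card (ends G e) = 2"
  using finite_loopless by (auto simp: finite_loopless_def)

lemma inj_point: "inj_on (point D) (verts G)"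
  and arc_curve: "e \<in> edges G \<Longrightarrow> arc (curve D e)"
  and curve_ends: "e \<in> edges G \<Longrightarrow> {pathstart (curve D e), pathfinish (curve D e)} = point D ` ends G e"
  and open_curve_verts: "e \<in> edges G \<Longrightarrow> open_curve D e \<inter> point D ` verts G = {}"
  and open_curve_disjoint: "e \<in> edges G \<Longrightarrow> f \<in> edges G \<Longrightarrow> e \<noteq> f \<Longrightarrow> open_curve D e \<inter> open_curve D f = {}"
  using plane_drawing by (auto simp: plane_drawing_def)

lemma arc_of_eq: "e \<in> edges G \<Longrightarrow> arc_of e = open_curve D e \<union> point D ` ends G e"
  unfolding curve_ends[symmetric] open_curve_def by auto

lemma open_curve_arc_of: "e \<in> edges G \<Longrightarrow> f \<in> edges G \<Longrightarrow> e \<noteq> f \<Longrightarrow> open_curve D e \<inter> arc_of f = {}"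
  using open_curve_disjoint[of e f] open_curve_verts[of e] ends_verts[of f] by (auto simp: arc_of_eq)

text \<open>The interior of an edge misses every other edge, so a common point is an end of both;
  injectivity of \<open>point D\<close> turns it into a common end vertex.\<close>

lemma arc_of_Int:
  assumes "e \<in> edges G" "f \<in> edges G" "e \<noteq> f"
  shows "arc_of e \<inter> arc_of f \<subseteq> point D ` (ends G e \<inter> ends G f)"
proof
  fix z assume z: "z \<in> arc_of e \<inter> arc_of f"
  then have "z \<in> point D ` ends G e" "z \<in> point D ` ends G f"
    using assms open_curve_arc_of[of e f] open_curve_arc_of[of f e] arc_of_eq by auto
  then show "z \<in> point D ` (ends G e \<inter> ends G f)"
    using inj_point ends_verts assms by (simp add: inj_on_image_Int)
qed

lemma arc_of_verts: "e \<in> edges G \<Longrightarrow> v \<in> verts G \<Longrightarrow> point D v \<in> arc_of e \<longleftrightarrow> v \<in> ends G e"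
  using open_curve_verts[of e] inj_point ends_verts[of e]
  by (auto simp: arc_of_eq inj_on_def)

lemma open_curve_nonempty: "e \<in> edges G \<Longrightarrow> open_curve D e \<noteq> {}"
  and connected_open_curve: "e \<in> edges G \<Longrightarrow> connected (open_curve D e)"
  unfolding open_curve_def using arc_curve arc_imp_simple_path
  by (metis nonempty_simple_path_endless, metis connected_simple_path_endless)

text \<open>The closed unit interval is the closure of the open one, and the curve is continuous.
  This passes from the interior of an edge to the whole edge, which the ends of a dual edge are
  defined by.\<close>

lemma closure_open_curve:
  assumes "e \<in> edges G" shows "arc_of e \<subseteq> closure (open_curve D e)"
proof -
  have a: "arc (curve D e)" using assms arc_curve by blast
  then have "open_curve D e = curve D e ` {0<..<1}"
    unfolding open_curve_def by (simp add: arc_imp_simple_path simple_path_endless)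
  moreover have "continuous_on (closure {0<..<1}) (curve D e)"
    using a by (simp add: arc_def path_def)
  then have "curve D e ` closure {0<..<1} \<subseteq> closure (curve D e ` {0<..<1})"
    by (intro image_closure_subset) (auto intro: closure_subset[THEN subsetD])
  ultimately show ?thesis by (simp add: path_image_def)
qed

lemma open_curve_subset_arc: "open_curve D e \<subseteq> arc_of e"
  by (auto simp: open_curve_def)

lemma arc_of_subset: "e \<in> edges G \<Longrightarrow> arc_of e \<subseteq> K"
  by (auto simp: drawn_set_def)

lemma compact_curves: "E \<subseteq> edges G \<Longrightarrow> compact (curves E)"
  unfolding curves_def using finite_edges arc_curve
  by (intro compact_UN) (auto intro: finite_subset compact_arc_image)

lemma drawn_set_eq: "K = point D ` verts G \<union> curves (edges G)"
  by (simp add: drawn_set_def curves_def)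

lemma compact_drawn_set: "compact K"
  unfolding drawn_set_eq using compact_curves finite_verts
  by (intro compact_Un finite_imp_compact[of "point D ` verts G"]) auto

lemma closed_drawn_set: "closed K"
  using compact_drawn_set compact_imp_closed by blast

text \<open>What remains is the drawing with the edge deleted but its ends kept, which is
  compact.\<close>

lemma closed_minus_open_curve:
  assumes "e \<in> edges G" shows "closed (K - open_curve D e)"
proof -
  have "K - open_curve D e = point D ` verts G \<union> curves (edges G - {e})"
  proof -
    have "arc_of e - open_curve D e \<subseteq> point D ` verts G"
      using arc_of_eq ends_verts assms by blast
    then show ?thesis
      using open_curve_verts[OF assms] open_curve_arc_of[OF assms]
      unfolding drawn_set_eq curves_def by fastforce
  qed
  moreover have "compact (point D ` verts G \<union> curves (edges G - {e}))"
    using compact_curves finite_verts by (intro compact_Un finite_imp_compact[of "point D ` verts G"]) auto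
  ultimately show ?thesis using compact_imp_closed by metis
qed

lemma curves_subset: "E \<subseteq> edges G \<Longrightarrow> curves E \<subseteq> K"
  by (auto simp: curves_def drawn_set_def)

section \<open>Drawn paths and cycles\<close>

lemma orient_curve:
  assumes "e \<in> edges G" "ends G e = {u, v}"
  obtains c where "arc c" "pathstart c = point D u" "pathfinish c = point D v" "path_image c = arc_of e"
proof -
  have "{pathstart (curve D e), pathfinish (curve D e)} = {point D u, point D v}"
    using curve_ends assms by simp
  then consider "pathstart (curve D e) = point D u" "pathfinish (curve D e) = point D v"
    | "pathstart (curve D e) = point D v" "pathfinish (curve D e) = point D u"
    by (auto simp: doubleton_eq_iff)
  then show thesis
  proof cases
    case 1
    then show ?thesis using that arc_curve[OF assms(1)] by blast
  next
    case 2
    then show ?thesis using that[of "reversepath (curve D e)"] arc_curve[OF assms(1)]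
      by (simp add: arc_reversepath)
  qed
qed

text \<open>By induction on the path: the arc of the first edge meets the drawing of the rest only
  at their common vertex, because the first vertex does not recur. A path without edges is excluded
  since a single point is not an arc.\<close>

lemma path_arc:
  assumes "graph_path G vs es" "es \<noteq> []"
  shows "\<exists>c. arc c \<and> pathstart c = point D (hd vs) \<and> pathfinish c = point D (last vs) \<and>
    path_image c = curves (set es)"
  using assms
proof (induction es arbitrary: vs)
  case (Cons e es)
  obtain v ws where w: "vs = v # ws" "v \<notin> set ws" "e \<in> edges G"
    "ends G e = {v, hd ws}" "graph_path G ws es"
    using Cons.prems by (auto simp: graph_path_Cons)
  have ws: "ws \<noteq> []" using w graph_path_not_Nil by blast
  obtain c1 where c1: "arc c1" "pathstart c1 = point D v" "pathfinish c1 = point D (hd ws)"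
    "path_image c1 = arc_of e"
    using orient_curve w by metis
  show ?case
  proof (cases "es = []")
    case True
    then show ?thesis using c1 w ws by (auto simp: curves_def)
  next
    case False
    then obtain c2 where c2: "arc c2" "pathstart c2 = point D (hd ws)"
      "pathfinish c2 = point D (last ws)" "path_image c2 = curves (set es)"
      using Cons.IH w by blast
    have "path_image c1 \<inter> path_image c2 \<subseteq> {pathstart c2}"
    proof
      fix z assume z: "z \<in> path_image c1 \<inter> path_image c2"
      then obtain f where f: "f \<in> set es" "z \<in> arc_of f" "z \<in> arc_of e"
        using c1 c2 by (auto simp: curves_def)
      have "f \<in> edges G" "ends G f \<subseteq> set ws"
        using f w graph_path_edges graph_path_ends_subset by fastforce+
      then have "e \<noteq> f" "ends G e \<inter> ends G f \<subseteq> {hd ws}" using w by auto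
      then show "z \<in> {pathstart c2}"
        using arc_of_Int[of e f] f w \<open>f \<in> edges G\<close> c2 by auto
    qed
    then have "arc (c1 +++ c2)" using c1 c2 by (intro arc_join) auto
    moreover have "path_image (c1 +++ c2) = curves (set (e # es))"
      using c1 c2 by (simp add: path_image_join curves_def)
    ultimately show ?thesis using c1 c2 w ws
      by (intro exI[of _ "c1 +++ c2"]) auto
  qed
qed simp

text \<open>A cycle with a distinguished edge \<open>d\<close>. If \<open>es\<close> consists of
  tree edges, this is the fundamental cycle of \<open>d\<close>.\<close>

definition closing :: "'e \<Rightarrow> 'v list \<Rightarrow> 'e list \<Rightarrow> bool" where
  "closing d vs es \<longleftrightarrow> graph_path G vs es \<and> d \<in> edges G - set es \<and> ends G d = {hd vs, last vs}"

text \<open>The drawn path and the drawn edge \<open>d\<close> are arcs that share exactly their end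
  points. Removing the interior of \<open>d\<close> leaves the drawn path; its connectedness is
  recorded for \<open>jordan_arc_faces\<close>.\<close>

lemma closing_curve:
  assumes "closing d vs es"
  obtains c where "simple_path c" "pathfinish c = pathstart c"
    "path_image c = curves (insert d (set es))"
    "connected (path_image c - open_curve D d)"
proof -
  note a = assms[unfolded closing_def]
  have d: "d \<in> edges G" and p: "graph_path G vs es" using a by auto
  \<comment> \<open>As there are no loops, the path has at least one edge and hence is drawn as an
    arc.\<close>
  have "hd vs \<noteq> last vs" using card_ends[OF d] a by auto
  then have "es \<noteq> []" using p by auto
  then obtain c1 where c1: "arc c1" "pathstart c1 = point D (hd vs)"
    "pathfinish c1 = point D (last vs)" "path_image c1 = curves (set es)"
    using path_arc p by blast
  obtain c2 where c2: "arc c2" "pathstart c2 = point D (last vs)"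
    "pathfinish c2 = point D (hd vs)" "path_image c2 = arc_of d"
    using orient_curve[of d "last vs" "hd vs"] a by (metis insert_commute d)
  have es: "set es \<subseteq> edges G - {d}" using a graph_path_edges by fastforce
  have "path_image c1 \<inter> path_image c2 \<subseteq> {pathstart c1, pathstart c2}"
  proof
    fix z assume "z \<in> path_image c1 \<inter> path_image c2"
    then obtain f where f: "f \<in> set es" "z \<in> arc_of f" "z \<in> arc_of d"
      using c1 c2 by (auto simp: curves_def)
    then have "z \<in> point D ` ends G d" using arc_of_Int[of d f] es d by auto
    then show "z \<in> {pathstart c1, pathstart c2}" using a c1 c2 by auto
  qed
  then have "simple_path (c1 +++ c2)" using c1 c2 by (intro simple_path_join_loop) auto
  moreover have im: "path_image (c1 +++ c2) = curves (insert d (set es))"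
    using c1 c2 by (auto simp: path_image_join curves_def)
  moreover have "path_image (c1 +++ c2) - open_curve D d = path_image c1"
  proof -
    have "point D ` ends G d \<subseteq> path_image c1"
      using a c1 pathstart_in_path_image[of c1] pathfinish_in_path_image[of c1] by auto
    moreover have "path_image c1 \<inter> open_curve D d = {}"
      using c1(4) es open_curve_arc_of[OF d] by (fastforce simp: curves_def)
    ultimately show ?thesis using c1 c2 arc_of_eq[OF d] by (auto simp: path_image_join)
  qed
  moreover have "connected (path_image c1)" using c1(1) by (rule connected_arc_image)
  ultimately show thesis using that[of "c1 +++ c2"] c1 c2 by auto
qed

section \<open>Faces on the two sides of a cycle\<close>

text \<open>Faces are nonempty, connected and disjoint from the drawing, so one pair of points
  decides for all pairs. If \<open>E\<close> is a cycle, this means the same side of a Jordan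
  curve.\<close>

definition same_side :: "'e set \<Rightarrow> complex set \<Rightarrow> complex set \<Rightarrow> bool" where
  "same_side E F H \<longleftrightarrow> (\<forall>x\<in>F. \<forall>y\<in>H. connected_component (- curves E) x y)"

lemma face_nonempty: "F \<in> faces G D \<Longrightarrow> F \<noteq> {}"
  by (auto simp: faces_def in_components_nonempty)

lemma same_side_refl: "F \<in> faces G D \<Longrightarrow> E \<subseteq> edges G \<Longrightarrow> same_side E F F"
proof -
  assume F: "F \<in> faces G D" and E: "E \<subseteq> edges G"
  have "connected F" using F in_components_connected unfolding faces_def by blast
  moreover have "F \<subseteq> - curves E"
    using F curves_subset[OF E] in_components_subset unfolding faces_def by blast
  ultimately show ?thesis unfolding same_side_def connected_component_def by blast
qed

lemma same_side_sym: "same_side E F H \<Longrightarrow> same_side E H F"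
  unfolding same_side_def by (meson connected_component_sym)

lemma same_side_trans:
  "same_side E F H \<Longrightarrow> same_side E H I \<Longrightarrow> H \<in> faces G D \<Longrightarrow> same_side E F I"
  unfolding same_side_def by (metis connected_component_trans ex_in_conv face_nonempty)

lemma dual_simps [simp]: "verts dual = faces G D" "edges dual = edges G"
  by (auto simp: dual_graph_def)

lemma dual_ends: "F \<in> ends dual e \<longleftrightarrow> F \<in> faces G D \<and> arc_of e \<subseteq> frontier F"
  by (auto simp: dual_graph_def)

text \<open>Both faces have a point of the interior of \<open>f\<close> in their closure, and this
  point is off the curves of \<open>E\<close>; adding it to both faces links them.\<close>

lemma dual_edge_not_crossing:
  assumes f: "f \<in> edges G" "f \<notin> E" "E \<subseteq> edges G" and FH: "F \<in> ends dual f" "H \<in> ends dual f"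
  shows "same_side E F H"
proof -
  obtain p where p: "p \<in> open_curve D f" using open_curve_nonempty f by blast
  have "p \<notin> arc_of e" if "e \<in> E" for e
    using open_curve_arc_of[of f e] f p that by blast
  then have "p \<notin> curves E" by (simp add: curves_def)
  have *: "connected (insert p X) \<and> insert p X \<subseteq> - curves E" if X: "X \<in> ends dual f" for X
  proof -
    have "X \<in> components (- K)" using X by (auto simp: dual_ends faces_def)
    then have "connected X" "X \<subseteq> - curves E"
      using curves_subset[OF f(3)] in_components_connected in_components_subset by blast+
    moreover have "p \<in> closure X"
      using X p open_curve_subset_arc[of f] unfolding dual_ends frontier_def by blast
    then have "connected (insert p X)"
      using \<open>connected X\<close> closure_subset by (intro connected_intermediate_closure[of X "insert p X"]) auto
    ultimately show ?thesis using \<open>p \<notin> curves E\<close> by auto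
  qed
  have "connected (insert p F \<union> insert p H)"
    using *[OF FH(1)] *[OF FH(2)] by (intro connected_Un) auto
  moreover have "insert p F \<union> insert p H \<subseteq> - curves E" using *[OF FH(1)] *[OF FH(2)] by auto
  ultimately show ?thesis unfolding same_side_def connected_component_def by blast
qed

text \<open>This is \<open>jordan_arc_faces\<close> for the drawn cycle and the interior of
  \<open>d\<close>: one face inside, one outside. The neighbourhood \<open>U\<close> excludes a
  third face at \<open>d\<close>, and it is kept in the conclusion for the openness argument in
  \<open>rooted_exists\<close>.\<close>

lemma closing_dual_ends:
  assumes "closing d vs es"
  obtains F H U where "ends dual d = {F, H}" "F \<in> faces G D" "H \<in> faces G D"
    "\<not> same_side (insert d (set es)) F H"
    "open U" "open_curve D d \<subseteq> U" "U \<subseteq> open_curve D d \<union> F \<union> H"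
proof -
  have d: "d \<in> edges G" using assms by (auto simp: closing_def)
  have es: "insert d (set es) \<subseteq> edges G"
    using assms graph_path_edges by (fastforce simp: closing_def)
  obtain c where c: "simple_path c" "pathfinish c = pathstart c"
    "path_image c = curves (insert d (set es))" "connected (path_image c - open_curve D d)"
    using closing_curve[OF assms] .
  have cK: "path_image c \<subseteq> K" using c curves_subset[OF es] by simp
  have oc: "open_curve D d \<subseteq> path_image c"
    using c open_curve_subset_arc by (fastforce simp: curves_def)
  obtain F H U where FH: "F \<in> components (- K)" "H \<in> components (- K)"
    "F \<subseteq> inside (path_image c)" "H \<subseteq> outside (path_image c)"
    "open_curve D d \<subseteq> frontier F" "open_curve D d \<subseteq> frontier H"
    "open U" "open_curve D d \<subseteq> U" "U \<subseteq> open_curve D d \<union> F \<union> H"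
    using jordan_arc_faces[OF c(1,2) cK closed_drawn_set closed_minus_open_curve[OF d] oc
      connected_open_curve[OF d] open_curve_nonempty[OF d] c(4)] .
  have fr: "arc_of d \<subseteq> frontier X" if "open_curve D d \<subseteq> frontier X" for X
    using closure_minimal[OF that frontier_closed] closure_open_curve[OF d] by (rule order_trans[rotated])
  have faces: "F \<in> faces G D" "H \<in> faces G D" using FH by (auto simp: faces_def)
  \<comment> \<open>A face with \<open>d\<close> in its frontier meets \<open>U\<close>, but not the
    interior of \<open>d\<close>, so it meets \<open>F\<close> or \<open>H\<close> and coincides
    with it.\<close>
  have "X = F \<or> X = H" if X: "X \<in> ends dual d" for X
  proof -
    obtain p where p: "p \<in> open_curve D d" using open_curve_nonempty[OF d] by blast
    then have "p \<in> closure X"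
      using X open_curve_subset_arc[of d] unfolding dual_ends frontier_def by blast
    then have "U \<inter> X \<noteq> {}" using p FH(7,8) open_Int_closure_eq_empty[of U X] by blast
    moreover have XK: "X \<in> components (- K)" using X by (auto simp: dual_ends faces_def)
    moreover have "open_curve D d \<inter> X = {}"
      using oc cK in_components_subset[OF XK] by blast
    ultimately have "X \<inter> F \<noteq> {} \<or> X \<inter> H \<noteq> {}" using FH(9) by blast
    then show ?thesis using components_nonoverlap[OF XK FH(1)] components_nonoverlap[OF XK FH(2)] by simp
  qed
  moreover have "F \<in> ends dual d" "H \<in> ends dual d" using faces FH(5,6) fr by (auto simp: dual_ends)
  ultimately have "ends dual d = {F, H}" by blast
  moreover have "\<not> same_side (insert d (set es)) F H"
  proof
    assume s: "same_side (insert d (set es)) F H"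
    obtain x y where "x \<in> F" "y \<in> H" using faces face_nonempty by blast
    then have "connected_component (- path_image c) x y" using s c(3) by (auto simp: same_side_def)
    then have "y \<in> inside (path_image c)"
      by (rule inside_same_component) (use \<open>x \<in> F\<close> FH(3) in auto)
    then show False using \<open>y \<in> H\<close> FH(4) inside_Int_outside[of "path_image c"] by blast
  qed
  ultimately show thesis using that[of F H U] faces FH(7,8,9) by simp
qed

section \<open>The outer face\<close>

lemma outer_face_eq: "F \<in> faces G D \<and> \<not> bounded F \<longleftrightarrow> F = outside K"
  unfolding faces_def using bounded_unique_outside[of K F] compact_drawn_set
  by (simp add: compact_imp_bounded)

lemma outer_eq_outside: "outer = outside K"
  unfolding outer_face_def outer_face_eq by simp

lemma outer_face: "outer \<in> faces G D" "\<not> bounded outer"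
  using outer_face_eq[of outer] outer_eq_outside by auto

lemma bounded_faces_iff: "F \<in> bounded_faces G D \<longleftrightarrow> F \<in> faces G D \<and> F \<noteq> outer"
  using outer_face_eq[of F] outer_eq_outside by (auto simp: bounded_faces_def)

lemma ends_doubleton:
  assumes "e \<in> edges G"
  obtains u v where "ends G e = {u, v}" "u \<noteq> v" "u \<in> verts G" "v \<in> verts G"
  using card_ends[OF assms] ends_verts[OF assms] by (auto simp: card_2_iff)

text \<open>The planarity arguments below end by contradicting this. Symmetry of
  \<open>same_side\<close> makes the order of the two faces irrelevant.\<close>

lemma closing_not_same_side:
  assumes "closing d vs es" "ends dual d = {A, B}"
  shows "\<not> same_side (insert d (set es)) A B"
proof -
  obtain F H U where "ends dual d = {F, H}" "\<not> same_side (insert d (set es)) F H"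
    using assms(1) by (rule closing_dual_ends)
  moreover from this have "A = F \<and> B = H \<or> A = H \<and> B = F"
    using assms(2) by (auto simp: doubleton_eq_iff)
  ultimately show ?thesis using same_side_sym[of _ A B] by auto
qed

lemma dual_path_same_side:
  assumes "graph_path dual Fs es" "set es \<inter> E = {}" "E \<subseteq> edges G"
  shows "same_side E (hd Fs) (last Fs)"
  using assms
proof (induction es arbitrary: Fs)
  case Nil
  then show ?case by (auto intro: same_side_refl)
next
  case (Cons e es)
  obtain F Hs where p: "Fs = F # Hs" "e \<in> edges G" "ends dual e = {F, hd Hs}" "graph_path dual Hs es"
    using Cons.prems by (auto simp: graph_path_Cons)
  have Hs: "Hs \<noteq> []" using p graph_path_not_Nil by blast
  then have "hd Hs \<in> faces G D" using graph_path_verts[OF p(4)] by auto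
  moreover have "same_side E F (hd Hs)"
    using p Cons.prems by (intro dual_edge_not_crossing[of e]) auto
  moreover have "same_side E (hd Hs) (last Hs)" using p Cons by simp
  ultimately show ?case using p Hs same_side_trans by auto
qed

end


section \<open>Dual paths avoiding a spanning tree\<close>

locale plane_tree = plane_graph G D
  for G :: "('v, 'e) multigraph" and D :: "('v, 'e) drawing" +
  fixes T :: "'e set"
  assumes tree: "spanning_tree G T"
begin

lemma tree_subset: "T \<subseteq> edges G"
  and tree_joined: "u \<in> verts G \<Longrightarrow> v \<in> verts G \<Longrightarrow> joined (spanning_subgraph G T) u v"
  using tree by (auto simp: spanning_tree_def graph_connected_def)

text \<open>A path between the ends of \<open>e\<close> in the rest of the tree would close up with
  \<open>e\<close> to a cycle.\<close>

lemma tree_edge_separates: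
  assumes "e \<in> T" "ends G e = {u, v}"
  shows "\<not> joined (spanning_subgraph G (T - {e})) u v"
proof
  assume "joined (spanning_subgraph G (T - {e})) u v"
  then obtain vs es where "graph_path (spanning_subgraph G (T - {e})) vs es" "hd vs = u" "last vs = v"
    unfolding joined_def by blast
  moreover have "T - {e} \<subseteq> edges G" using tree_subset by blast
  ultimately have "graph_path (spanning_subgraph G T) vs es \<and> e \<in> T - set es \<and> ends G e = {last vs, hd vs}"
    using assms tree_subset by (auto simp: graph_path_spanning_subgraph)
  then show False using tree unfolding spanning_tree_def graph_acyclic_def by auto
qed

section \<open>The complement of a drawn tree\<close>

text \<open>The invariant for building \<open>T\<close> edge by edge. Connectedness of the
  complement is the property to be carried along; that \<open>R\<close> joins all of
  \<open>V\<close> finally yields \<open>R = T\<close>.\<close>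

definition subtree :: "'v set \<Rightarrow> 'e set \<Rightarrow> bool" where
  "subtree V R \<longleftrightarrow> V \<subseteq> verts G \<and> V \<noteq> {} \<and> R \<subseteq> T \<and> (\<forall>e\<in>R. ends G e \<subseteq> V) \<and>
     (\<forall>u\<in>V. \<forall>v\<in>V. joined (spanning_subgraph G R) u v) \<and>
     connected (- (point D ` V \<union> curves R))"

text \<open>A tree edge leaving \<open>V\<close> meets the drawn subtree in a single point. An arc
  does not separate the plane, so by Janiszewski's theorem neither does the union.\<close>

lemma subtree_grow:
  assumes "subtree V R" "V \<noteq> verts G"
  shows "\<exists>v\<in>verts G - V. \<exists>e. subtree (insert v V) (insert e R)"
proof -
  note st = assms(1)[unfolded subtree_def]
  obtain x y where xy: "x \<in> V" "y \<in> verts G" "y \<notin> V" using st assms(2) by blast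
  then have "(x, y) \<in> (steps (spanning_subgraph G T))\<^sup>*"
    using tree_joined[of x y] st joined_iff by fastforce
  then obtain a b where ab: "(a, b) \<in> steps (spanning_subgraph G T)" "a \<in> V" "b \<notin> V"
    using xy by (blast elim: rtrancl_leaves)
  then obtain e where e: "e \<in> T" "ends G e = {a, b}" and b: "b \<in> verts G"
    by (auto simp: steps_def)
  have eG: "e \<in> edges G" using e tree_subset by blast
  have RG: "R \<subseteq> edges G" using st tree_subset by blast
  have eR: "e \<notin> R" using st e ab by auto
  let ?A = "point D ` V \<union> curves R"
  \<comment> \<open>The only end of \<open>e\<close> in \<open>V\<close> is \<open>a\<close>, and
    edges of \<open>R\<close> have both ends in \<open>V\<close>.\<close>
  have "?A \<inter> arc_of e = {point D a}"
  proof (intro equalityI subsetI)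
    fix z assume z: "z \<in> ?A \<inter> arc_of e"
    show "z \<in> {point D a}"
    proof (cases "z \<in> point D ` V")
      case True
      then obtain v where v: "z = point D v" "v \<in> V" by blast
      then have "v \<in> ends G e" using z arc_of_verts[OF eG, of v] st by auto
      then show ?thesis using e v ab by auto
    next
      case False
      then obtain f where f: "f \<in> R" "z \<in> arc_of f" using z by (auto simp: curves_def)
      then have "z \<in> point D ` (ends G e \<inter> ends G f)"
        using arc_of_Int[OF eG, of f] RG eR z by blast
      moreover have "ends G e \<inter> ends G f \<subseteq> {a}" using st f e ab by auto
      ultimately show ?thesis by auto
    qed
  next
    fix z assume "z \<in> {point D a}"
    then show "z \<in> ?A \<inter> arc_of e" using ab e arc_of_verts[OF eG, of a] st by auto
  qed
  then have con: "connected (?A \<inter> arc_of e)" by simp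
  have V: "finite V" using st finite_verts finite_subset by blast
  have A: "compact ?A"
    using compact_curves[OF RG] finite_imp_compact[of "point D ` V"] V by (intro compact_Un) auto
  have cl: "closed (arc_of e)" using arc_curve[OF eG] compact_arc_image compact_imp_closed by blast
  have "connected (- arc_of e)" using arc_curve[OF eG] by (intro connected_arc_complement) auto
  moreover have "connected (- ?A)" using st by blast
  ultimately have "connected_component (- (?A \<union> arc_of e)) p q"
    if "p \<in> - (?A \<union> arc_of e)" "q \<in> - (?A \<union> arc_of e)" for p q
    using that connected_component_Un_closed[OF A cl con, of p q]
    unfolding connected_iff_connected_component by simp
  then have "connected (- (?A \<union> arc_of e))"
    by (simp add: connected_iff_connected_component)
  moreover have "?A \<union> arc_of e = point D ` insert b V \<union> curves (insert e R)"
    using e b arc_of_verts[OF eG b] by (auto simp: curves_def)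
  ultimately have "connected (- (point D ` insert b V \<union> curves (insert e R)))" by simp
  moreover have "joined (spanning_subgraph G (insert e R)) u v"
    if "u \<in> insert b V" "v \<in> insert b V" for u v
  proof -
    let ?H = "spanning_subgraph G (insert e R)"
    have *: "joined ?H a w" if "w \<in> insert b V" for w
    proof (cases "w = b")
      case True
      then show ?thesis using e b ab st by (intro joined_edge[of e]) auto
    next
      case False
      then have "joined (spanning_subgraph G R) a w" using that st ab by blast
      then show ?thesis by (rule joined_spanning_subgraph_mono) auto
    qed
    show ?thesis using joined_trans[OF joined_sym[OF *[OF that(1)]] *[OF that(2)]] .
  qed
  ultimately have "subtree (insert b V) (insert e R)"
    unfolding subtree_def using st e b ab by auto
  then show ?thesis using b ab by blast
qed

lemma connected_tree_complement: "connected (- (point D ` verts G \<union> curves T))"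
proof -
  have "verts G \<noteq> {}" using tree by (auto simp: spanning_tree_def graph_connected_def)
  \<comment> \<open>Growth starts from a single vertex, whose complement is the punctured
    plane.\<close>
  have "\<exists>V R. subtree V R \<and> card V = Suc n" if "n < card (verts G)" for n
    using that
  proof (induction n)
    case 0
    obtain v where "v \<in> verts G" using \<open>verts G \<noteq> {}\<close> by blast
    then have "subtree {v} {}"
      unfolding subtree_def curves_def
      by (auto simp: joined_refl connected_punctured_universe)
    then show ?case by (intro exI[of _ "{v}"] exI[of _ "{}"]) simp
  next
    case (Suc n)
    then obtain V R where VR: "subtree V R" "card V = Suc n" by auto
    then have "V \<noteq> verts G" using Suc.prems by auto
    then obtain v e where ve: "v \<in> verts G - V" "subtree (insert v V) (insert e R)"
      using subtree_grow VR by blast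
    have "finite V" using VR(2) by (intro card_ge_0_finite) simp
    then show ?case using ve VR by (intro exI[of _ "insert v V"] exI[of _ "insert e R"]) auto
  qed
  moreover have "0 < card (verts G)" using \<open>verts G \<noteq> {}\<close> finite_verts by (simp add: card_gt_0_iff)
  ultimately obtain V R where VR: "subtree V R" "card V = card (verts G)"
    by (metis Suc_pred' lessI)
  note st = VR(1)[unfolded subtree_def]
  have V: "V = verts G" by (rule card_subset_eq[OF finite_verts _ VR(2)]) (use st in blast)
  \<comment> \<open>The ends of a missing tree edge would be joined by \<open>R\<close>, hence by
    the tree without that edge.\<close>
  have "R = T"
  proof (rule ccontr)
    assume "R \<noteq> T"
    then obtain e where e: "e \<in> T" "e \<notin> R" using st by blast
    then have "e \<in> edges G" using tree_subset by blast
    then obtain u v where uv: "ends G e = {u, v}" "u \<in> verts G" "v \<in> verts G"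
      by (rule ends_doubleton)
    then have "joined (spanning_subgraph G R) u v" using st V by blast
    then have "joined (spanning_subgraph G (T - {e})) u v"
      by (rule joined_spanning_subgraph_mono) (use st e in auto)
    then show False using tree_edge_separates[OF e(1) uv(1)] by contradiction
  qed
  then show ?thesis using st V by simp
qed

section \<open>Fundamental cycles\<close>

lemma closing_from_joined:
  assumes "d \<in> edges G" "d \<notin> R" "R \<subseteq> edges G" "ends G d = {u, v}" "joined (spanning_subgraph G R) u v"
  obtains vs es where "closing d vs es" "set es \<subseteq> R"
proof -
  obtain vs es where "graph_path (spanning_subgraph G R) vs es" "hd vs = u" "last vs = v"
    using assms(5) unfolding joined_def by blast
  then show thesis using that[of vs es] assms
    by (auto simp: graph_path_spanning_subgraph closing_def)
qed

lemma nontree_closing: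
  assumes "d \<in> edges G - T"
  obtains vs es where "closing d vs es" "set es \<subseteq> T"
proof -
  obtain u v where "ends G d = {u, v}" "u \<in> verts G" "v \<in> verts G"
    by (rule ends_doubleton[of d]) (use assms in blast)
  then show thesis
    using assms by (intro closing_from_joined[of d T u v, OF _ _ tree_subset _ tree_joined that]) simp_all
qed

section \<open>Dual paths from the outer face\<close>

text \<open>The path starts at the outer face, so that if it is nonempty it competes in the
  \<open>index\<close> of \<open>F\<close> for its first edge. Its edges avoid
  \<open>T\<close>.\<close>

definition rooted :: "complex set \<Rightarrow> complex set list \<Rightarrow> 'e list \<Rightarrow> bool" where
  "rooted F Fs es \<longleftrightarrow> graph_path dual Fs es \<and> set es \<inter> T = {} \<and> hd Fs = outer \<and> last Fs = F"

lemma rooted_path: "rooted F Fs es \<Longrightarrow> graph_path dual Fs es"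
  by (simp add: rooted_def)

lemma rooted_face:
  assumes "rooted F Fs es" shows "F \<in> faces G D"
proof -
  have "Fs \<noteq> []" "set Fs \<subseteq> faces G D"
    using graph_path_not_Nil[OF rooted_path[OF assms]] graph_path_verts[OF rooted_path[OF assms]]
    by simp_all
  then show ?thesis using assms last_in_set[of Fs] by (auto simp: rooted_def)
qed

lemma rooted_outer: "rooted outer [outer] []"
  using outer_face by (simp add: rooted_def)

lemma rooted_take:
  assumes "rooted F Fs es" "k \<le> length es"
  shows "rooted (Fs ! k) (take (Suc k) Fs) (take k es)"
proof -
  have "length Fs = Suc (length es)" using assms graph_path_length rooted_path by blast
  then have "last (take (Suc k) Fs) = Fs ! k" "hd (take (Suc k) Fs) = hd Fs"
    using assms(2) by (simp add: take_Suc_conv_app_nth, simp add: hd_take)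
  moreover have "set (take k es) \<inter> T = {}"
    using assms(1) set_take_subset[of k es] by (auto simp: rooted_def)
  ultimately show ?thesis
    using assms graph_path_take[OF rooted_path[OF assms(1)] assms(2)] by (simp add: rooted_def)
qed

lemma rooted_snoc:
  assumes "rooted F Fs es" "d \<in> edges G - T" "ends dual d = {F, H}"
  shows "\<exists>Hs hs. rooted H Hs hs"
proof (cases "H \<in> set Fs")
  case True
  then obtain k where k: "k < length Fs" "Fs ! k = H" by (auto simp: in_set_conv_nth)
  then show ?thesis
    using rooted_take[OF assms(1), of k] graph_path_length[OF rooted_path[OF assms(1)]] by auto
next
  case False
  have "H \<in> faces G D" using assms(3) dual_ends by blast
  moreover have "Fs \<noteq> []" using assms(1) rooted_path graph_path_not_Nil by blast
  ultimately have "rooted H (Fs @ [H]) (es @ [d])"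
    using assms False graph_path_snoc[of dual Fs es H d] by (auto simp: rooted_def)
  then show ?thesis by blast
qed

text \<open>The complement of the drawn tree is connected. If some face were unreachable, the
  reachable and the unreachable faces, each completed by the non-tree edges between them, would
  split that complement into two open sets.\<close>

lemma rooted_exists:
  assumes "F \<in> faces G D" shows "\<exists>Fs es. rooted F Fs es"
proof (rule ccontr)
  assume not: "\<nexists>Fs es. rooted F Fs es"
  let ?P = "\<lambda>F. \<exists>Fs es. rooted F Fs es"
  let ?W = "- (point D ` verts G \<union> curves T)"
  \<comment> \<open>Used for \<open>?P\<close> and for its negation; a non-tree edge is included
    when all faces at it satisfy the predicate.\<close>
  define X where "X P = \<Union>{F \<in> faces G D. P F} \<union>
    \<Union>(open_curve D ` {d \<in> edges G - T. \<forall>A\<in>ends dual d. P A})" for P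
  \<comment> \<open>A rooted path can be continued across any non-tree edge, in both
    directions.\<close>
  have inv: "?P A \<longleftrightarrow> ?P B" if "d \<in> edges G - T" "ends dual d = {A, B}" for d A B
    using rooted_snoc[OF _ that(1), of A _ _ B] rooted_snoc[OF _ that(1), of B _ _ A] that(2)
    by (auto simp: insert_commute)
  \<comment> \<open>A point of a face has that face as a neighbourhood; for a point on a non-tree
    edge \<open>closing_dual_ends\<close> supplies one made of the edge and its two faces.\<close>
  have op: "open (X P)" if inv: "\<And>d A B. d \<in> edges G - T \<Longrightarrow> ends dual d = {A, B} \<Longrightarrow> P A = P B" for P
  proof (subst open_subopen, intro ballI)
    fix x assume "x \<in> X P"
    then consider A where "A \<in> faces G D" "P A" "x \<in> A"
      | d where "d \<in> edges G - T" "\<forall>A\<in>ends dual d. P A" "x \<in> open_curve D d"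
      unfolding X_def by blast
    then show "\<exists>U. open U \<and> x \<in> U \<and> U \<subseteq> X P"
    proof cases
      case 1
      then have "open A" using open_components[of "- K" A] closed_drawn_set by (auto simp: faces_def open_Compl)
      then show ?thesis using 1 by (intro exI[of _ A]) (auto simp: X_def)
    next
      case 2
      obtain vs es where "closing d vs es" using nontree_closing[OF 2(1)] by blast
      then obtain A B U where "ends dual d = {A, B}" "A \<in> faces G D" "B \<in> faces G D"
        "open U" "open_curve D d \<subseteq> U" "U \<subseteq> open_curve D d \<union> A \<union> B"
        by (rule closing_dual_ends) blast
      moreover from this have "A \<subseteq> X P" "B \<subseteq> X P" "open_curve D d \<subseteq> X P"
        using 2(1,2) unfolding X_def by auto
      ultimately show ?thesis using 2(3) by (intro exI[of _ U]) auto
    qed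
  qed
  have disj: "open_curve D d \<inter> A = {}" if "d \<in> edges G" "A \<in> faces G D" for d A
  proof -
    have "A \<subseteq> - K" using that(2) in_components_subset unfolding faces_def by blast
    then show ?thesis using open_curve_subset_arc[of d] arc_of_subset[OF that(1)] by blast
  qed
  have two: "\<exists>A B. ends dual d = {A, B}" if "d \<in> edges G - T" for d
  proof -
    obtain vs es where "closing d vs es" by (rule nontree_closing[OF \<open>d \<in> edges G - T\<close>])
    then show ?thesis by (rule closing_dual_ends) blast
  qed
  let ?X = "X ?P" and ?Y = "X (\<lambda>F. \<not> ?P F)"
  have disjoint: "?X \<inter> ?Y = {}"
  proof (rule equals0I)
    fix x assume x: "x \<in> ?X \<inter> ?Y"
    show False
    proof (cases "x \<in> K")
      case True
      then have "x \<notin> A" if "A \<in> faces G D" for A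
        using that in_components_subset unfolding faces_def by blast
      moreover have "x \<in> ?X" "x \<in> ?Y" using x by auto
      ultimately obtain d d' where d: "d \<in> edges G - T" "\<forall>A\<in>ends dual d. ?P A" "x \<in> open_curve D d"
        "d' \<in> edges G - T" "\<forall>A\<in>ends dual d'. \<not> ?P A" "x \<in> open_curve D d'"
        unfolding X_def by auto
      then have "d = d'" using open_curve_disjoint[of d d'] by blast
      then show False using d two[OF d(1)] by auto
    next
      case False
      then have "x \<notin> open_curve D d" if "d \<in> edges G" for d
        using open_curve_subset_arc[of d] arc_of_subset[OF that] by blast
      moreover have "x \<in> ?X" "x \<in> ?Y" using x by auto
      ultimately obtain A B where "A \<in> faces G D" "?P A" "x \<in> A" "B \<in> faces G D" "\<not> ?P B" "x \<in> B"
        unfolding X_def by auto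
      then show False using components_nonoverlap[of A "- K" B] unfolding faces_def by blast
    qed
  qed
  \<comment> \<open>A point of the drawing that is neither a vertex nor on the tree is interior to a
    non-tree edge, and by \<open>inv\<close> its two faces agree.\<close>
  have cover: "?W \<subseteq> ?X \<union> ?Y"
  proof
    fix x assume x: "x \<in> ?W"
    show "x \<in> ?X \<union> ?Y"
    proof (cases "x \<in> K")
      case True
      then obtain d where d: "d \<in> edges G - T" "x \<in> arc_of d"
        using x by (auto simp: drawn_set_eq curves_def)
      then have dG: "d \<in> edges G" by blast
      have "x \<notin> point D ` ends G d" using x ends_verts[OF dG] by auto
      then have "x \<in> open_curve D d" using d arc_of_eq[OF dG] by auto
      moreover obtain A B where AB: "ends dual d = {A, B}" using two[OF d(1)] by blast
      then have "(\<forall>E\<in>ends dual d. ?P E) \<or> (\<forall>E\<in>ends dual d. \<not> ?P E)"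
        using inv[OF d(1) AB] unfolding AB by blast
      ultimately show ?thesis using d(1) unfolding X_def by blast
    next
      case False
      then obtain A where "A \<in> faces G D" "x \<in> A"
        using Union_components[of "- K"] unfolding faces_def by blast
      then show ?thesis unfolding X_def by blast
    qed
  qed
  have W: "A \<subseteq> ?W" if "A \<in> faces G D" for A
  proof -
    have "A \<subseteq> - K" using that in_components_subset unfolding faces_def by blast
    then show ?thesis using curves_subset[OF tree_subset] unfolding drawn_set_def by blast
  qed
  have "open ?X" using inv by (rule op)
  moreover have "open ?Y" by (rule op) (use inv in simp)
  ultimately have "?X \<inter> ?W = {} \<or> ?Y \<inter> ?W = {}"
    using cover disjoint by (intro connectedD[OF connected_tree_complement]) simp_all
  moreover have "outer \<subseteq> ?X" using rooted_outer outer_face(1) unfolding X_def by blast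
  moreover have "F \<subseteq> ?Y" using not assms unfolding X_def by blast
  ultimately show False
    using W[OF assms] W[OF outer_face(1)] face_nonempty[OF assms] face_nonempty[OF outer_face(1)]
    by blast
qed

section \<open>Crossing fundamental cycles\<close>

text \<open>Suppose \<open>f\<close> and \<open>h\<close> differ. The first path crosses the
  fundamental cycle of \<open>f\<close> only with its first edge, the second path not at all. Going
  from the outer face along the second path to \<open>H\<close>, over to \<open>F\<close> and back
  along the first path then reaches the other face at \<open>f\<close> without crossing that
  cycle.\<close>

lemma rooted_labels_agree:
  assumes P: "rooted F Fs (f # fs)" and Q: "rooted H Hs (h # hs)"
    and FH: "F = H \<or> (\<exists>d\<in>edges G - T. ends dual d = {F, H} \<and> F \<noteq> outer \<and> H \<noteq> outer)"
  shows "f = h"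
proof (rule ccontr)
  assume "f \<noteq> h"
  obtain Fs' where Fs: "Fs = outer # Fs'" "outer \<notin> set Fs'" "f \<in> edges G" "ends dual f = {outer, hd Fs'}"
    "graph_path dual Fs' fs" "last Fs = F"
    using P by (auto simp: rooted_def graph_path_Cons)
  obtain Hs' where Hs: "Hs = outer # Hs'" "outer \<notin> set Hs'" "graph_path dual Hs' hs"
    using Q by (auto simp: rooted_def graph_path_Cons)
  have fT: "f \<in> edges G - T" using P Fs by (auto simp: rooted_def)
  obtain vs es where c: "closing f vs es" "set es \<subseteq> T" using nontree_closing[OF fT] .
  define E where "E = insert f (set es)"
  have E: "E \<subseteq> edges G" using c fT tree_subset by (auto simp: E_def)
  have "Fs' \<noteq> []" using Fs graph_path_not_Nil by blast
  have "f \<notin> set fs" using graph_path_distinct_edges[OF rooted_path[OF P]] by simp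
  then have "set fs \<inter> E = {}" using P c by (auto simp: rooted_def E_def)
  then have 1: "same_side E (hd Fs') F"
    using dual_path_same_side[OF Fs(5) _ E] Fs \<open>Fs' \<noteq> []\<close> by auto
  \<comment> \<open>The edge \<open>f\<close> is incident with the outer face, to which a path
    cannot return.\<close>
  have "f \<notin> set hs"
  proof
    assume "f \<in> set hs"
    then have "outer \<in> set Hs'" using graph_path_ends_subset[OF Hs(3)] Fs(4) by blast
    then show False using Hs by blast
  qed
  then have "set (h # hs) \<inter> E = {}" using Q c \<open>f \<noteq> h\<close> by (auto simp: rooted_def E_def)
  then have 2: "same_side E outer H"
    using dual_path_same_side[OF rooted_path[OF Q] _ E] Q by (simp add: rooted_def)
  have HF: "F \<in> faces G D" "H \<in> faces G D"
    using P Q rooted_face by blast+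
  have 3: "same_side E F H"
  proof (cases "F = H")
    case True
    then show ?thesis using same_side_refl HF E by blast
  next
    case False
    then obtain d where d: "d \<in> edges G - T" "ends dual d = {F, H}" "F \<noteq> outer" "H \<noteq> outer"
      using FH by blast
    \<comment> \<open>Here the faces have to be bounded: \<open>f\<close> has the outer face as an
      end.\<close>
    then have "d \<noteq> f" using Fs(4) by auto
    then have "d \<notin> E" using d c by (auto simp: E_def)
    then show ?thesis using dual_edge_not_crossing[of d E F H] d E by auto
  qed
  have "same_side E outer (hd Fs')"
    using same_side_trans[OF same_side_trans[OF 2 same_side_sym[OF 3]] same_side_sym[OF 1]] HF by blast
  then show False using closing_not_same_side[OF c(1) Fs(4)] by (simp add: E_def)
qed

text \<open>At a common edge both paths reach a common face. Cut off there, they are rooted paths to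
  the same face, so their first edges agree.\<close>

lemma rooted_disjoint:
  assumes P: "rooted F Fs (f # fs)" and Q: "rooted H Hs (h # hs)" and "f \<noteq> h"
  shows "set (f # fs) \<inter> set (h # hs) = {}"
proof (rule ccontr)
  assume "set (f # fs) \<inter> set (h # hs) \<noteq> {}"
  then obtain i j where ij: "i < length (f # fs)" "j < length (h # hs)" "(f # fs) ! i = (h # hs) ! j"
    by (metis disjoint_iff in_set_conv_nth)
  have eq: "{Fs ! i, Fs ! Suc i} = {Hs ! j, Hs ! Suc j}"
    using graph_path_ends[OF rooted_path[OF P] ij(1)] graph_path_ends[OF rooted_path[OF Q] ij(2)] ij(3)
    by simp
  have lP: "length Fs = Suc (length (f # fs))" and lQ: "length Hs = Suc (length (h # hs))"
    using P Q graph_path_length rooted_path by blast+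
  have "Fs ! Suc i \<noteq> Fs ! 0" "Hs ! Suc j \<noteq> Hs ! 0"
    using graph_path_distinct[OF rooted_path[OF P]] graph_path_distinct[OF rooted_path[OF Q]] ij lP lQ
    by (auto simp: nth_eq_iff_index_eq)
  moreover have "Fs ! 0 = outer" "Hs ! 0 = outer"
    using P Q lP lQ unfolding rooted_def by (metis hd_conv_nth list.size(3) nat.simps(3))+
  \<comment> \<open>The common face must not be the initial one, so that the truncated paths keep
    their first edges. If the edge is traversed in opposite directions, \<open>j\<close> is positive
    and its predecessor serves as \<open>l\<close>.\<close>
  ultimately obtain k l where kl: "k < length (f # fs)" "l < length (h # hs)" "Fs ! Suc k = Hs ! Suc l"
  proof -
    consider "Fs ! Suc i = Hs ! Suc j" | "Fs ! Suc i = Hs ! j" "Fs ! i = Hs ! Suc j"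
      using eq by (auto simp: doubleton_eq_iff)
    then show thesis
    proof cases
      case 1
      then show ?thesis using that ij by blast
    next
      case 2
      then have "j \<noteq> 0" using \<open>Fs ! Suc i \<noteq> Fs ! 0\<close> \<open>Fs ! 0 = outer\<close> \<open>Hs ! 0 = outer\<close> by metis
      then show ?thesis using that[of i "j - 1"] ij 2 by auto
    qed
  qed
  have "rooted (Fs ! Suc k) (take (Suc (Suc k)) Fs) (f # take k fs)"
    using rooted_take[OF P, of "Suc k"] kl by simp
  moreover have "rooted (Fs ! Suc k) (take (Suc (Suc l)) Hs) (h # take l hs)"
    using rooted_take[OF Q, of "Suc l"] kl by simp
  ultimately show False using rooted_labels_agree \<open>f \<noteq> h\<close> by blast
qed

text \<open>Otherwise \<open>g\<close> closes a cycle with edges of \<open>T - {e}\<close>, which is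
  crossed by the first path at \<open>g\<close> alone and neither by the second path nor by
  \<open>e\<close>. From one face at \<open>g\<close> one can go back to the outer face, along the
  second path to \<open>H\<close>, across \<open>e\<close> to \<open>F\<close>, and back to the
  other face at \<open>g\<close>, always on one side.\<close>

lemma crossing_tree_edge:
  assumes e: "e \<in> T" "F \<in> ends dual e" "H \<in> ends dual e"
    and P: "rooted F Ps ps" and Q: "rooted H Qs qs"
    and g: "g \<in> set ps" "g \<notin> set qs" "ends G g = {u, v}"
  shows "\<not> joined (spanning_subgraph G (T - {e})) u v"
proof
  assume j: "joined (spanning_subgraph G (T - {e})) u v"
  have gG: "g \<in> edges G" "g \<notin> T"
    using g P graph_path_edges[OF rooted_path[OF P]] by (auto simp: rooted_def)
  obtain vs es where c: "closing g vs es" "set es \<subseteq> T - {e}"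
    using closing_from_joined[OF gG(1) _ _ g(3) j] gG tree_subset by blast
  define E where "E = insert g (set es)"
  have E: "E \<subseteq> edges G" using c gG tree_subset by (auto simp: E_def)
  obtain i where i: "i < length ps" "ps ! i = g" using g(1) by (auto simp: in_set_conv_nth)
  have l: "length Ps = Suc (length ps)" using P graph_path_length rooted_path by blast
  have d: "distinct ps" using graph_path_distinct_edges rooted_path P by blast
  have faces: "\<And>k. k < length Ps \<Longrightarrow> Ps ! k \<in> faces G D" "F \<in> faces G D" "H \<in> faces G D"
    using graph_path_verts[OF rooted_path[OF P]] e dual_ends by auto
  have "g \<notin> set (take i ps)"
    using i d by (auto simp: in_set_conv_nth nth_eq_iff_index_eq)
  \<comment> \<open>The path is split at its only occurrence of \<open>g\<close>, the edge with
    index \<open>i\<close>; neither piece crosses the cycle.\<close>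
  then have 1: "same_side E outer (Ps ! i)"
    using rooted_take[OF P, of i] i c dual_path_same_side[of "take (Suc i) Ps" "take i ps" E] E
    unfolding rooted_def E_def by auto
  have dr: "graph_path dual (drop (Suc i) Ps) (drop (Suc i) ps)"
    using graph_path_drop[OF rooted_path[OF P], of "Suc i"] i by simp
  have "g \<notin> set (drop (Suc i) ps)"
    using i d by (auto simp: in_set_conv_nth nth_eq_iff_index_eq)
  then have "set (drop (Suc i) ps) \<inter> E = {}"
    using P c set_drop_subset[of "Suc i" ps] by (auto simp: rooted_def E_def)
  then have 2: "same_side E (Ps ! Suc i) F"
    using dual_path_same_side[OF dr _ E] i l P by (simp add: hd_drop_conv_nth rooted_def)
  have "e \<notin> E" using e c gG by (auto simp: E_def)
  then have 3: "same_side E F H"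
    using dual_edge_not_crossing[of e E F H] e E tree_subset by auto
  have "set qs \<inter> E = {}" using Q c g by (auto simp: rooted_def E_def)
  then have 4: "same_side E outer H"
    using dual_path_same_side[OF rooted_path[OF Q] _ E] Q by (simp add: rooted_def)
  have "same_side E (Ps ! i) outer" using 1 by (rule same_side_sym)
  then have "same_side E (Ps ! i) H" using same_side_trans[OF _ 4] outer_face by blast
  then have "same_side E (Ps ! i) F" using same_side_trans[OF _ same_side_sym[OF 3]] faces by blast
  then have "same_side E (Ps ! i) (Ps ! Suc i)"
    using same_side_trans[OF _ same_side_sym[OF 2]] faces by blast
  moreover have "ends dual g = {Ps ! i, Ps ! Suc i}"
    using graph_path_ends[OF rooted_path[OF P] i(1)] i by simp
  ultimately show False using closing_not_same_side[OF c(1)] by (simp add: E_def)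
qed

section \<open>Lower bounds for the congestion of the tree\<close>

lemma tree_congestion_ge:
  assumes "e \<in> T" shows "edge_congestion G T e \<le> tree_congestion G T"
  unfolding tree_congestion_def using assms tree_subset finite_edges finite_subset
  by (intro Max_ge) auto

lemma congestion_ge_paths:
  assumes e: "e \<in> T" "F \<in> ends dual e" "H \<in> ends dual e"
    and P: "rooted F Ps ps" and Q: "rooted H Qs qs" and disj: "set ps \<inter> set qs = {}"
  shows "length ps + length qs + 1 \<le> tree_congestion G T"
proof -
  let ?X = "insert e (set ps \<union> set qs)"
  have PQ: "set ps \<inter> T = {}" "set qs \<inter> T = {}" "set ps \<subseteq> edges G" "set qs \<subseteq> edges G"
    using P Q graph_path_edges[OF rooted_path[OF P]] graph_path_edges[OF rooted_path[OF Q]]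
    by (simp_all add: rooted_def)
  have "distinct ps" "distinct qs"
    using graph_path_distinct_edges[OF rooted_path[OF P]]
      graph_path_distinct_edges[OF rooted_path[OF Q]] by simp_all
  then have "card (set ps \<union> set qs) = length ps + length qs"
    using disj by (simp add: card_Un_disjoint distinct_card)
  moreover have "e \<notin> set ps \<union> set qs" using e PQ by blast
  ultimately have "length ps + length qs + 1 = card ?X" by simp
  also have "\<dots> \<le> edge_congestion G T e"
  proof (rule edge_congestion_ge[OF finite_edges])
    show X: "?X \<subseteq> edges G" using e PQ tree_subset by blast
    fix g assume g: "g \<in> ?X"
    then have "g \<in> edges G" using X by (rule subsetD[rotated])
    then obtain u v where uv: "ends G g = {u, v}" "u \<in> verts G" "v \<in> verts G"
      by (rule ends_doubleton)
    consider "g = e" | "g \<in> set ps" "g \<notin> set qs" | "g \<in> set qs" "g \<notin> set ps"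
      using g disj by blast
    then have "\<not> joined (spanning_subgraph G (T - {e})) u v"
    proof cases
      case 1
      then show ?thesis using tree_edge_separates[OF e(1)] uv(1) by simp
    next
      case 2
      then show ?thesis using crossing_tree_edge[OF e P Q _ _ uv(1)] by simp
    next
      case 3
      then show ?thesis using crossing_tree_edge[OF e(1,3,2) Q P _ _ uv(1)] by simp
    qed
    then show "\<exists>u v. u \<in> verts G \<and> v \<in> verts G \<and> ends G g = {u, v} \<and>
        \<not> joined (spanning_subgraph G (T - {e})) u v"
      using uv by blast
  qed
  also have "\<dots> \<le> tree_congestion G T" using e(1) by (rule tree_congestion_ge)
  finally show ?thesis .
qed

text \<open>If a tree edge \<open>t\<close> of the fundamental cycle of \<open>d\<close> is removed,
  both \<open>t\<close> and \<open>d\<close> join different components. This settles the case of a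
  tail whose last edge is not in the tree.\<close>

lemma congestion_ge_two:
  assumes "d \<in> edges G - T" shows "2 \<le> tree_congestion G T"
proof -
  obtain vs es where c: "closing d vs es" "set es \<subseteq> T" using nontree_closing[OF assms] .
  obtain u v where uv: "ends G d = {u, v}" "u \<noteq> v" "u \<in> verts G" "v \<in> verts G"
    by (rule ends_doubleton) (use assms in blast)
  have p: "graph_path G vs es" "ends G d = {hd vs, last vs}" using c by (auto simp: closing_def)
  have "es \<noteq> []" using p uv by (auto simp: doubleton_eq_iff)
  then obtain t ts where es: "es = t # ts" by (cases es) auto
  then obtain w ws where w: "vs = w # ws" "w \<notin> set ws" "ends G t = {w, hd ws}" "graph_path G ws ts"
    using p by (auto simp: graph_path_Cons)
  have ws: "ws \<noteq> []" using w graph_path_not_Nil by blast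
  let ?H = "spanning_subgraph G (T - {t})"
  have t: "t \<in> T" "t \<notin> set ts" using c es graph_path_distinct_edges[OF p(1)] by auto
  then have "graph_path ?H ws ts"
    using w c es tree_subset by (subst graph_path_spanning_subgraph) auto
  then have "joined ?H (hd ws) (last ws)" unfolding joined_def by blast
  then have "joined ?H (last ws) (hd ws)" by (rule joined_sym)
  \<comment> \<open>The rest of the tree path still joins the far end of \<open>t\<close> with
    \<open>last ws\<close>.\<close>
  then have nj: "\<not> joined ?H w (last ws)"
    using tree_edge_separates[OF t(1) w(3)] joined_trans[of ?H w "last ws" "hd ws"] by blast
  have "card {t, d} \<le> edge_congestion G T t"
  proof (rule edge_congestion_ge[OF finite_edges])
    show "{t, d} \<subseteq> edges G" using t assms tree_subset by blast
    fix g assume g: "g \<in> {t, d}"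
    have "w \<in> verts G" "hd ws \<in> verts G" "last ws \<in> verts G"
      using graph_path_verts[OF p(1)] w(1) ws by auto
    moreover have "ends G d = {w, last ws}" using p(2) w(1) ws by simp
    ultimately show "\<exists>u v. u \<in> verts G \<and> v \<in> verts G \<and> ends G g = {u, v} \<and> \<not> joined ?H u v"
      using g nj w(3) tree_edge_separates[OF t(1) w(3)] by blast
  qed
  moreover have "t \<noteq> d" using t assms by auto
  then have "card {t, d} = 2" by simp
  ultimately show ?thesis using tree_congestion_ge[OF t(1)] by simp
qed

section \<open>Labels of bounded faces\<close>

lemma index_le:
  assumes "rooted F Fs (f # fs)" shows "index G D F f \<le> enat (length (f # fs))"
  unfolding index_def using assms by (intro Inf_lower) (force simp: rooted_def)

text \<open>A relation rather than a function, since the outer face has no label; for bounded faces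
  existence and uniqueness follow below.\<close>

definition label :: "complex set \<Rightarrow> 'e \<Rightarrow> bool" where
  "label F f \<longleftrightarrow> (\<exists>Fs fs. rooted F Fs (f # fs))"

text \<open>A rooted path to a bounded face is nonempty, and its second face is bounded because the
  outer face does not recur. Hence its first edge is an outer edge.\<close>

lemma label_exists:
  assumes "F \<in> bounded_faces G D"
  obtains f where "label F f" "f \<in> outer_edges G D"
proof -
  have F: "F \<in> faces G D" "F \<noteq> outer" using assms by (auto simp: bounded_faces_iff)
  obtain Fs es where p: "rooted F Fs es" using rooted_exists[OF F(1)] by blast
  have "es \<noteq> []" using p F(2) by (auto simp: rooted_def)
  then obtain f fs where es: "es = f # fs" by (cases es) auto
  then obtain Hs where Hs: "Fs = outer # Hs" "outer \<notin> set Hs" "f \<in> edges G"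
    "ends dual f = {outer, hd Hs}" "graph_path dual Hs fs"
    using p by (auto simp: rooted_def graph_path_Cons)
  have "hd Hs \<in> set Hs" using graph_path_not_Nil[OF Hs(5)] by simp
  then have "hd Hs \<in> faces G D" "hd Hs \<noteq> outer" using Hs(2) graph_path_verts[OF Hs(5)] by auto
  then have "hd Hs \<in> bounded_faces G D" by (simp add: bounded_faces_iff)
  then have "f \<in> outer_edges G D" using Hs(3,4) by (auto simp: outer_edges_def)
  then show thesis using that[of f] p es label_def by blast
qed

lemma label_unique: "label F f \<Longrightarrow> label F h \<Longrightarrow> f = h"
  unfolding label_def using rooted_labels_agree by blast

text \<open>By \<open>rooted_labels_agree\<close> the edge \<open>d\<close> between the faces is in
  \<open>T\<close>, and by \<open>rooted_disjoint\<close> the two paths have no common edge, so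
  \<open>congestion_ge_paths\<close> applies.\<close>

lemma label_change_bound:
  assumes d: "d \<in> edges G" "ends dual d = {F, H}"
    and FH: "F \<noteq> outer" "H \<noteq> outer"
    and fh: "label F f" "label H h" "f \<noteq> h"
  shows "index G D F f + index G D H h + 1 \<le> enat (tree_congestion G T)"
proof -
  obtain Fs fs Hs hs where P: "rooted F Fs (f # fs)" and Q: "rooted H Hs (h # hs)"
    using fh by (auto simp: label_def)
  have "d \<in> T" using rooted_labels_agree[OF P Q] d FH fh(3) by blast
  then have "length (f # fs) + length (h # hs) + 1 \<le> tree_congestion G T"
    using congestion_ge_paths[OF _ _ _ P Q rooted_disjoint[OF P Q fh(3)]] d(2) by simp
  then have "enat (length (f # fs)) + enat (length (h # hs)) + 1 \<le> enat (tree_congestion G T)"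
    by (simp add: one_enat_def)
  then show ?thesis
    using add_mono[OF add_mono[OF index_le[OF P] index_le[OF Q]] order_refl[of 1]] by (rule order_trans[rotated])
qed

text \<open>If \<open>d\<close> is in \<open>T\<close>, the empty path at the outer face serves as
  second path. If not, \<open>d\<close> alone is a rooted path to \<open>F\<close>, so
  \<open>f = d\<close> with index at most 1, and the congestion is at least 2.\<close>

lemma tip_bound:
  assumes d: "d \<in> edges G" "ends dual d = {F, outer}" and F: "F \<noteq> outer" and f: "label F f"
  shows "index G D F f + 1 \<le> enat (tree_congestion G T)"
proof -
  obtain Fs fs where P: "rooted F Fs (f # fs)" using f by (auto simp: label_def)
  obtain k where k: "index G D F f \<le> enat k" "k + 1 \<le> tree_congestion G T"
  proof (cases "d \<in> T")
    case True
    then have "length (f # fs) + length [] + 1 \<le> tree_congestion G T"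
      using congestion_ge_paths[OF True _ _ P rooted_outer] d(2) by simp
    then show ?thesis using that index_le[OF P] by simp
  next
    case False
    have "F \<in> faces G D" using d(2) dual_ends by blast
    then have R: "rooted F [outer, F] [d]"
      using False d F outer_face(1) by (auto simp: rooted_def graph_path_Cons insert_commute)
    then have "d = f" using label_unique f unfolding label_def by blast
    then have "index G D F f \<le> enat 1" using index_le[OF R] by simp
    moreover have "1 + 1 \<le> tree_congestion G T" using congestion_ge_two[of d] d(1) False by simp
    ultimately show ?thesis using that by blast
  qed
  have "index G D F f + 1 \<le> enat (k + 1)"
    using add_mono[OF k(1) order_refl[of 1]] by (simp add: one_enat_def)
  also have "\<dots> \<le> enat (tree_congestion G T)" using k(2) by simp
  finally show ?thesis .
qed

section \<open>Comparison with the congestion indicator\<close>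

lemma congestion_indicator_le:
  assumes S: "center_tail_system G D S"
  shows "congestion_indicator G D S \<le> enat (tree_congestion G T)"
proof (rule ccontr)
  let ?N = "enat (tree_congestion G T)"
  assume "\<not> congestion_indicator G D S \<le> ?N"
  then have "?N < congestion_indicator G D S" by simp
  then have
    N1: "?N < Inf {index G D F f + index G D H h + 1 | F H f h.
             F \<in> center S \<and> H \<in> center S \<and> adjacent dual F H \<and>
             f \<in> outer_edges G D \<and> h \<in> outer_edges G D \<and> f \<noteq> h}" and
    N2: "?N < Inf {index G D (tip (opp S e)) e + 1 | e. e \<in> outer_edges G D}" and
    N3: "?N < Inf {index G D (Fs ! k) e + index G D (Fs ! Suc k) e' + 1 | Fs k e e'.
             e \<in> outer_edges G D \<and> e' \<in> outer_edges G D \<and> e' \<noteq> e \<and>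
             Fs = butlast (fst (opp S e)) \<and> Suc k < length Fs}"
    unfolding congestion_indicator_def by simp_all
  note less_Inf = less_le_trans[OF _ Inf_lower]
  have center: "center S \<subseteq> bounded_faces G D"
    and con: "graph_connected (induced dual (center S))"
    and tails: "\<And>Fs es. (Fs, es) \<in> tails S \<Longrightarrow>
      graph_path dual Fs es \<and> hd Fs \<in> center S \<and> last Fs = outer"
    and opp: "\<And>e. e \<in> outer_edges G D \<Longrightarrow> opp S e \<in> tails S"
    using S by (auto simp: center_tail_system_def)
  let ?I = "induced dual (center S)"
  have [simp]: "verts ?I = center S" "edges ?I = {e \<in> edges G. ends dual e \<subseteq> center S}"
    "ends ?I = ends dual"
    by (auto simp: induced_def)
  have bounded: "F \<in> faces G D" "F \<noteq> outer" if "F \<in> center S" for F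
    using that center bounded_faces_iff by blast+
  obtain F0 where F0: "F0 \<in> center S" using con by (auto simp: graph_connected_def)
  \<comment> \<open>The label of one face of the center selects the outer edge whose opposite tail
    is followed.\<close>
  obtain e where e: "label F0 e" "e \<in> outer_edges G D" using label_exists center F0 by blast
  \<comment> \<open>The label spreads over the connected center: a change across a dual edge would
    contradict \<open>N1\<close>.\<close>
  have center_label: "label F e" if "F \<in> center S" for F
  proof -
    have "(F0, F) \<in> (steps ?I)\<^sup>*" using con F0 that by (auto simp: graph_connected_def joined_iff)
    then show ?thesis
    proof induction
      case base
      show ?case by (rule e(1))
    next
      case (step A B)
      then obtain d where d: "d \<in> edges G" "ends dual d = {A, B}" "A \<in> center S" "B \<in> center S"
        by (auto simp: steps_def)
      obtain h where h: "label B h" "h \<in> outer_edges G D" using label_exists center d(4) by blast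
      show ?case
      proof (rule ccontr)
        assume "\<not> label B e"
        then have "A \<noteq> B" "e \<noteq> h" using step.IH h(1) by auto
        then have "adjacent dual A B" using d by (auto simp: adjacent_def)
        then have "?N < index G D A e + index G D B h + 1"
          using d e(2) h(2) \<open>e \<noteq> h\<close> by (intro less_Inf[OF N1]) blast
        moreover have "index G D A e + index G D B h + 1 \<le> ?N"
          using label_change_bound[OF d(1,2)] bounded d step.IH h(1) \<open>e \<noteq> h\<close> by simp
        ultimately show False by simp
      qed
    qed
  qed
  obtain Fs es where opp_e: "opp S e = (Fs, es)" by fastforce
  then have p: "graph_path dual Fs es" and hd: "hd Fs \<in> center S" and last: "last Fs = outer"
    using tails opp[OF e(2)] by auto
  have len: "length Fs = Suc (length es)" using graph_path_length[OF p] .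
  then have "Fs \<noteq> []" by auto
  then have last_nth: "Fs ! length es = outer" using last len by (simp add: last_conv_nth)
  have Fs: "Fs ! k \<in> faces G D" "Fs ! k \<noteq> outer" if "k < length es" for k
  proof -
    show "Fs ! k \<in> faces G D" using graph_path_verts[OF p] that len by (simp add: subset_iff)
    show "Fs ! k \<noteq> outer"
      using last_nth graph_path_distinct[OF p] that len nth_eq_iff_index_eq[of Fs k "length es"] by simp
  qed
  \<comment> \<open>The range of \<open>k\<close> covers the faces of the tail up to its tip and
    leaves out the outer face at index \<open>length es\<close>. A change of label along the tail
    would contradict \<open>N3\<close>.\<close>
  have tail_label: "label (Fs ! k) e" if "k < length es" for k
    using that
  proof (induction k)
    case 0
    then show ?case using center_label[OF hd] \<open>Fs \<noteq> []\<close> by (simp add: hd_conv_nth)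
  next
    case (Suc k)
    then have IH: "label (Fs ! k) e" and k: "k < length es" by simp_all
    have "Fs ! Suc k \<in> bounded_faces G D" using Fs[OF Suc.prems] by (simp add: bounded_faces_iff)
    then obtain h where h: "label (Fs ! Suc k) h" "h \<in> outer_edges G D" by (rule label_exists)
    show ?case
    proof (rule ccontr)
      assume "\<not> label (Fs ! Suc k) e"
      then have "e \<noteq> h" using h(1) by auto
      have "index G D (Fs ! k) e + index G D (Fs ! Suc k) h + 1 \<le> ?N"
        using label_change_bound[OF _ graph_path_ends[OF p k] Fs(2)[OF k] Fs(2)[OF Suc.prems] IH h(1) \<open>e \<noteq> h\<close>]
          graph_path_edges[OF p] k by (simp add: subset_iff)
      moreover have "?N < index G D (butlast Fs ! k) e + index G D (butlast Fs ! Suc k) h + 1"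
        by (rule less_Inf[OF N3], rule CollectI, intro exI conjI, rule refl)
          (use e(2) h(2) \<open>e \<noteq> h\<close> opp_e Suc.prems len in auto)
      moreover have "butlast Fs ! k = Fs ! k" "butlast Fs ! Suc k = Fs ! Suc k"
        using Suc.prems len by (simp_all add: nth_butlast)
      ultimately show False by simp
    qed
  qed
  have "es \<noteq> []"
  proof
    assume "es = []"
    then have "hd Fs = outer" using last_nth \<open>Fs \<noteq> []\<close> by (simp add: hd_conv_nth)
    then show False using bounded hd by blast
  qed
  \<comment> \<open>The position of the tip, just before the outer face.\<close>
  define k where "k = length es - 1"
  have k: "k < length es" "Suc k = length es" using \<open>es \<noteq> []\<close> by (auto simp: k_def)
  have tip: "tip (opp S e) = Fs ! k"
  proof -
    have "butlast Fs \<noteq> []" using k len by (metis length_butlast diff_Suc_1 list.size(3) nat.distinct(1))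
    then show ?thesis using k len opp_e by (simp add: tip_def last_conv_nth nth_butlast k_def)
  qed
  have "ends dual (es ! k) = {Fs ! k, outer}" using graph_path_ends[OF p k(1)] k(2) last_nth by simp
  moreover have "es ! k \<in> edges G" using graph_path_edges[OF p] k(1) by (simp add: subset_iff)
  \<comment> \<open>The tip still has the label \<open>e\<close>, which contradicts
    \<open>N2\<close>.\<close>
  ultimately have "index G D (Fs ! k) e + 1 \<le> ?N"
    using tip_bound Fs(2)[OF k(1)] tail_label[OF k(1)] by blast
  moreover have "?N < index G D (tip (opp S e)) e + 1"
    using e(2) by (intro less_Inf[OF N2]) blast
  ultimately show False using tip by simp
qed

end

theorem theorem1:
  fixes G :: "('v, 'e) multigraph" and D :: "('v, 'e) drawing" and S :: "'e center_tail"
  assumes "finite_loopless G" and "graph_connected G"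
    and "plane_drawing G D"
    and "center_tail_system G D S"
  shows "enat (spanning_tree_congestion G) \<ge> congestion_indicator G D S"
proof -
  interpret plane_graph G D using assms by unfold_locales
  have "{T. spanning_tree G T} \<subseteq> Pow (edges G)" by (auto simp: spanning_tree_def)
  then have "finite {T. spanning_tree G T}" by (rule finite_subset) (simp add: finite_edges)
  moreover have "{T. spanning_tree G T} \<noteq> {}"
    using exists_spanning_tree[OF finite_edges assms(2)] by blast
  \<comment> \<open>The minimum is over a finite nonempty set, hence attained by some spanning
    tree.\<close>
  ultimately have "spanning_tree_congestion G \<in> tree_congestion G ` {T. spanning_tree G T}"
    unfolding spanning_tree_congestion_def by (intro Min_in) auto
  then obtain T where T: "spanning_tree G T" "spanning_tree_congestion G = tree_congestion G T"
    by blast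
  interpret plane_tree G D T using T(1) by unfold_locales
  show ?thesis using congestion_indicator_le[OF assms(4)] T(2) by simp
qed

end
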